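(* Let $\mathscr{A}$ be a $C^*$-algebra, $\mathscr{X}$ a Hilbert $\mathscr{A}$-module and $x,y\in\mathscr{X}$. The following are equivalent: (i) $x\perp_B y$, i.e. $\|x\|\le\|x+\lambda y\|$ for all $\lambda\in\mathbb{C}$; (ii) there exists $\varphi\in\Omega_x$ such that $\varphi(\langle x,y\rangle)=0$; (iii) $\|x+\lambda y\|^2\ge\|x\|^2+|\lambda|^2 m(y)$ for all $\lambda\in\mathbb{C}$, where $m(y):=\inf\{\varphi(\langle y,y\rangle):\varphi\in\mathcal{S}(\mathscr{A})\}$.
   Context: A Hilbert $\mathscr{A}$-module is a right $\mathscr{A}$-module $\mathscr{X}$ with an $\mathscr{A}$-valued inner product $\langle\cdot,\cdot\rangle$, linear in the second variable and conjugate-linear in the first, with $\langle x,ya\rangle=\langle x,y\rangle a$, $\langle x,y\rangle^*=\langle y,x\rangle$, $\langle x,x\rangle\ge 0$ with equality iff $x=0$, complete for the norm $\|x\|=\|\langle x,x\rangle\|^{1/2}$. A state on $\mathscr{A}$ is a positive linear functional of norm one; $\mathcal{S}(\mathscr{A})$ denotes the set of states. For $x\in\mathscr{X}$, $\Omega_x:=\{\varphi\in\mathcal{S}(\mathscr{A}):\varphi(\langle x,x\rangle)=\|x\|^2\}$. *)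

theory Defs
  imports Complex_Main
begin

class cvec = ab_group_add +
  fixes scaleC :: "complex \<Rightarrow> 'a \<Rightarrow> 'a" (infixr "*\<^sub>C" 75)
  assumes scaleC_add_right: "c *\<^sub>C (x + y) = c *\<^sub>C x + c *\<^sub>C y"
    and scaleC_add_left: "(c + d) *\<^sub>C x = c *\<^sub>C x + d *\<^sub>C x"
    and scaleC_scaleC: "c *\<^sub>C (d *\<^sub>C x) = (c * d) *\<^sub>C x"
    and scaleC_one: "1 *\<^sub>C x = x"

class cstar_algebra = cvec + real_normed_algebra + banach +
  fixes cstar :: "'a \<Rightarrow> 'a"
  assumes scaleR_scaleC: "r *\<^sub>R x = complex_of_real r *\<^sub>C x"
    and norm_scaleC: "norm (c *\<^sub>C x) = cmod c * norm x"
    and scaleC_mult_left: "(c *\<^sub>C x) * y = c *\<^sub>C (x * y)"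
    and scaleC_mult_right: "x * (c *\<^sub>C y) = c *\<^sub>C (x * y)"
    and cstar_cstar: "cstar (cstar x) = x"
    and cstar_add: "cstar (x + y) = cstar x + cstar y"
    and cstar_scaleC: "cstar (c *\<^sub>C x) = cnj c *\<^sub>C cstar x"
    and cstar_mult: "cstar (x * y) = cstar y * cstar x"
    and cstar_identity: "norm (cstar x * x) = (norm x)\<^sup>2"

definition positive :: "'a::cstar_algebra \<Rightarrow> bool" where
  "positive a \<longleftrightarrow> (\<exists>b. a = cstar b * b)"

definition is_state :: "('a::cstar_algebra \<Rightarrow> complex) \<Rightarrow> bool" where
  "is_state \<phi> \<longleftrightarrow>
     (\<forall>a b. \<phi> (a + b) = \<phi> a + \<phi> b) \<and>
     (\<forall>c a. \<phi> (c *\<^sub>C a) = c * \<phi> a) \<and>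
     (\<forall>a. positive a \<longrightarrow> Im (\<phi> a) = 0 \<and> Re (\<phi> a) \<ge> 0) \<and>
     bdd_above {cmod (\<phi> a) | a. norm a \<le> 1} \<and>
     Sup {cmod (\<phi> a) | a. norm a \<le> 1} = 1"

definition states :: "('a::cstar_algebra \<Rightarrow> complex) set" where
  "states = {\<phi>. is_state \<phi>}"

definition hnorm :: "('x \<Rightarrow> 'x \<Rightarrow> 'a::cstar_algebra) \<Rightarrow> 'x \<Rightarrow> real" where
  "hnorm ip x = sqrt (norm (ip x x))"

definition hilbert_module ::
  "('x::cvec \<Rightarrow> 'a::cstar_algebra \<Rightarrow> 'x) \<Rightarrow> ('x \<Rightarrow> 'x \<Rightarrow> 'a) \<Rightarrow> bool" where
  "hilbert_module act ip \<longleftrightarrow>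
     (\<forall>x y a. act (x + y) a = act x a + act y a) \<and>
     (\<forall>x a b. act x (a + b) = act x a + act x b) \<and>
     (\<forall>x a b. act (act x a) b = act x (a * b)) \<and>
     (\<forall>c x a. act (c *\<^sub>C x) a = c *\<^sub>C act x a) \<and>
     (\<forall>c x a. act x (c *\<^sub>C a) = c *\<^sub>C act x a) \<and>
     (\<forall>x y z. ip x (y + z) = ip x y + ip x z) \<and>
     (\<forall>c x y. ip x (c *\<^sub>C y) = c *\<^sub>C ip x y) \<and>
     (\<forall>x y z. ip (x + y) z = ip x z + ip y z) \<and>
     (\<forall>c x y. ip (c *\<^sub>C x) y = cnj c *\<^sub>C ip x y) \<and>
     (\<forall>x y a. ip x (act y a) = ip x y * a) \<and>
     (\<forall>x y. cstar (ip x y) = ip y x) \<and>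
     (\<forall>x. positive (ip x x)) \<and>
     (\<forall>x. ip x x = 0 \<longleftrightarrow> x = 0) \<and>
     (\<forall>X. (\<forall>e>0. \<exists>N. \<forall>m\<ge>N. \<forall>n\<ge>N. hnorm ip (X m - X n) < e)
          \<longrightarrow> (\<exists>L. (\<lambda>n. hnorm ip (X n - L)) \<longlonglongrightarrow> 0))"

definition Omega :: "('x \<Rightarrow> 'x \<Rightarrow> 'a::cstar_algebra) \<Rightarrow> 'x \<Rightarrow> ('a \<Rightarrow> complex) set" where
  "Omega ip x = {\<phi>\<in>states. \<phi> (ip x x) = complex_of_real ((hnorm ip x)\<^sup>2)}"

definition bj_orth :: "('x::cvec \<Rightarrow> 'x \<Rightarrow> 'a::cstar_algebra) \<Rightarrow> 'x \<Rightarrow> 'x \<Rightarrow> bool" where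
  "bj_orth ip x y \<longleftrightarrow> (\<forall>l::complex. hnorm ip x \<le> hnorm ip (x + l *\<^sub>C y))"

text \<open>m(y) = inf of phi(<y,y>) over all states (these values are real).\<close>
definition m_val :: "('x \<Rightarrow> 'x \<Rightarrow> 'a::cstar_algebra) \<Rightarrow> 'x \<Rightarrow> real" where
  "m_val ip y = Inf {Re (\<phi> (ip y y)) | \<phi>. \<phi> \<in> states}"

end

theory Submission
  imports Defs "HOL-Analysis.Bounded_Linear_Function"
begin

text \<open>
  If \<open>x\<close> is orthogonal to \<open>y\<close>, then \<open>a = \<langle>x,x\<rangle>\<close> satisfies
  \<open>t \<parallel>a\<parallel> \<le> \<parallel>t a + k + v\<parallel>\<close> for \<open>t \<ge> 0\<close>, \<open>k\<close> positive and \<open>v = \<lambda>\<langle>x,y\<rangle> + (\<lambda>\<langle>x,y\<rangle>)*\<close>: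
  the norm is monotone on positive elements, \<open>a + v + |\<lambda>|\<^sup>2 \<langle>y,y\<rangle>\<close> is again of the form
  \<open>\<langle>z,z\<rangle>\<close> with \<open>z = x + \<lambda>y\<close>, and the quadratic term is negligible for small \<open>\<lambda>\<close>. Hahn-Banach then
  gives a functional of norm one that attains its norm at \<open>a\<close>, is nonnegative on all \<open>b* b\<close>
  and vanishes on all \<open>v\<close>, that is, a state in \<open>\<Omega>\<^sub>x\<close> killing \<open>\<langle>x,y\<rangle>\<close>.

  The monotonicity of the norm rests on Kaplansky's theorem that \<open>b* b\<close> is positive. It is
  obtained here without Gelfand theory: positivity of \<open>h = h*\<close> is \<open>\<parallel>T - h\<parallel> \<le> T\<close>, square roots come
  from a monotone iteration, and spectral estimates are replaced by the unitaries \<open>k + i sqrt (1 - k\<^sup>2)\<close>.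
  As the algebra need not have a unit, this is done in its multiplier algebra.\<close>

section \<open>Sublinear functionals\<close>

definition sublinear :: "('v::real_vector \<Rightarrow> real) \<Rightarrow> bool" where
  "sublinear p \<longleftrightarrow> (\<forall>x y. p (x + y) \<le> p x + p y) \<and> (\<forall>t\<ge>0. \<forall>x. p (t *\<^sub>R x) \<le> t * p x)"

lemma sublinear_add: "sublinear p \<Longrightarrow> p (x + y) \<le> p x + p y"
  and sublinear_scale_le: "sublinear p \<Longrightarrow> 0 \<le> t \<Longrightarrow> p (t *\<^sub>R x) \<le> t * p x"
  by (auto simp: sublinear_def)

lemma sublinear_zero: "sublinear p \<Longrightarrow> p 0 = 0"
  using sublinear_add[of p 0 0] sublinear_scale_le[of p 0 0] by simp

lemma sublinear_neg: "sublinear p \<Longrightarrow> - p (- x) \<le> p x"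
  using sublinear_add[of p x "- x"] sublinear_zero[of p] by simp

lemma sublinear_scale:
  assumes "sublinear p" "0 \<le> t"
  shows "p (t *\<^sub>R x) = t * p x"
proof (cases "t = 0")
  case True
  then show ?thesis using sublinear_zero[OF assms(1)] by simp
next
  case False
  then have t: "t > 0" using assms by simp
  have "p ((1/t) *\<^sub>R (t *\<^sub>R x)) \<le> (1/t) * p (t *\<^sub>R x)"
    using t by (intro sublinear_scale_le[OF assms(1)]) simp
  then have "t * p x \<le> p (t *\<^sub>R x)" using t by (simp add: field_simps)
  then show ?thesis using sublinear_scale_le[OF assms, of x] by simp
qed

text \<open>The bound \<open>- q (- x)\<close> keeps each infimum finite. Subadditivity uses the
  chain: of two members, the smaller one serves both arguments at once.\<close>

lemma sublinear_INF_chain: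
  assumes ne: "C \<noteq> {}"
    and sub: "\<And>p. p \<in> C \<Longrightarrow> sublinear p"
    and le: "\<And>p. p \<in> C \<Longrightarrow> p \<le> q"
    and chain: "\<And>p p'. p \<in> C \<Longrightarrow> p' \<in> C \<Longrightarrow> p \<le> p' \<or> p' \<le> p"
  shows "sublinear (\<lambda>x. INF p\<in>C. p x)" "p \<in> C \<Longrightarrow> (INF p\<in>C. p x) \<le> p x"
proof -
  have bdd: "bdd_below ((\<lambda>p. p x) ` C)" for x
  proof (rule bdd_belowI2)
    fix p assume "p \<in> C"
    then show "- q (- x) \<le> p x"
      using sublinear_neg[OF sub, of p x] le_funD[OF le, of p "- x"] by simp
  qed
  show low: "(INF p\<in>C. p x) \<le> p x" if "p \<in> C" for p x
    using bdd that by (rule cINF_lower)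
  show "sublinear (\<lambda>x. INF p\<in>C. p x)"
    unfolding sublinear_def
  proof (intro conjI allI impI)
    fix x y
    have "(INF p\<in>C. p (x + y)) - p' y \<le> p x" if pp': "p \<in> C" "p' \<in> C" for p p'
    proof -
      obtain r where r: "r \<in> C" "r \<le> p" "r \<le> p'"
        using chain[OF pp'] pp' by auto
      have "(INF p\<in>C. p (x + y)) \<le> r x + r y"
        using low[OF r(1)] sublinear_add[OF sub[OF r(1)]] by (rule order_trans)
      also have "\<dots> \<le> p x + p' y" using r by (auto simp: le_fun_def intro: add_mono)
      finally show ?thesis by simp
    qed
    then have "(INF p\<in>C. p (x + y)) - p' y \<le> (INF p\<in>C. p x)" if "p' \<in> C" for p'
      using that by (intro cINF_greatest[OF ne])
    then have "(INF p\<in>C. p (x + y)) - (INF p\<in>C. p x) \<le> (INF p\<in>C. p y)"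
      by (intro cINF_greatest[OF ne]) (simp add: algebra_simps)
    then show "(INF p\<in>C. p (x + y)) \<le> (INF p\<in>C. p x) + (INF p\<in>C. p y)" by simp
  next
    fix t :: real and x assume t: "0 \<le> t"
    show "(INF p\<in>C. p (t *\<^sub>R x)) \<le> t * (INF p\<in>C. p x)"
    proof (cases "t = 0")
      case True
      obtain p where "p \<in> C" using ne by blast
      then show ?thesis using low[of p 0] sublinear_zero[OF sub] True by fastforce
    next
      case False
      have "(INF p\<in>C. p (t *\<^sub>R x)) / t \<le> p x" if "p \<in> C" for p
        using low[OF that, of "t *\<^sub>R x"] sublinear_scale[OF sub[OF that] t, of x] t False
        by (simp add: field_simps)
      then have "(INF p\<in>C. p (t *\<^sub>R x)) / t \<le> (INF p\<in>C. p x)"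
        by (intro cINF_greatest[OF ne])
      then show ?thesis using t False by (simp add: field_simps)
    qed
  qed
qed

text \<open>The expression under the infimum does not increase with \<open>t\<close>:
  \<open>t = 0\<close> gives \<open>D y \<le> p\<close>, and \<open>t = 1\<close> gives
  \<open>D y x \<le> p (x + y) - p y\<close>, which turns minimality into additivity.\<close>

lemma sublinear_directional:
  fixes p :: "'v::real_vector \<Rightarrow> real"
  assumes p: "sublinear p"
  defines "D \<equiv> \<lambda>y x. INF t\<in>{0..}. p (x + t *\<^sub>R y) - t * p y"
  shows "sublinear (D y)" "0 \<le> t \<Longrightarrow> D y x \<le> p (x + t *\<^sub>R y) - t * p y"
proof -
  have bdd: "bdd_below ((\<lambda>t. p (x + t *\<^sub>R y) - t * p y) ` {0..})" for x
  proof (rule bdd_belowI2)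
    fix t :: real assume "t \<in> {0..}"
    then show "- p (- x) \<le> p (x + t *\<^sub>R y) - t * p y"
      using sublinear_add[OF p, of "x + t *\<^sub>R y" "- x"] sublinear_scale[OF p, of t y] by simp
  qed
  show low: "D y x \<le> p (x + t *\<^sub>R y) - t * p y" if "0 \<le> t" for t x
    unfolding D_def using bdd by (rule cINF_lower) (use that in simp)
  have great: "m \<le> D y x" if "\<And>t. 0 \<le> t \<Longrightarrow> m \<le> p (x + t *\<^sub>R y) - t * p y" for m x
    unfolding D_def using that by (intro cINF_greatest) auto
  show "sublinear (D y)"
    unfolding sublinear_def
  proof (intro conjI allI impI)
    fix u v
    have "D y (u + v) - (p (v + s *\<^sub>R y) - s * p y) \<le> p (u + t *\<^sub>R y) - t * p y"
      if "0 \<le> s" "0 \<le> t" for s t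
    proof -
      have "D y (u + v) \<le> p ((u + t *\<^sub>R y) + (v + s *\<^sub>R y)) - (t + s) * p y"
        using low[of "t + s" "u + v"] that by (simp add: algebra_simps)
      also have "\<dots> \<le> p (u + t *\<^sub>R y) + p (v + s *\<^sub>R y) - (t + s) * p y"
        using sublinear_add[OF p] by simp
      finally show ?thesis by (simp add: algebra_simps)
    qed
    then have "D y (u + v) - (p (v + s *\<^sub>R y) - s * p y) \<le> D y u" if "0 \<le> s" for s
      using that by (intro great)
    then have "D y (u + v) - D y u \<le> D y v"
      by (intro great) (simp add: algebra_simps)
    then show "D y (u + v) \<le> D y u + D y v" by simp
  next
    fix s :: real and u assume s: "0 \<le> s"
    show "D y (s *\<^sub>R u) \<le> s * D y u"
    proof (cases "s = 0")
      case True
      then show ?thesis using low[of 0 0] sublinear_zero[OF p] by simp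
    next
      case False
      have "D y (s *\<^sub>R u) / s \<le> p (u + t *\<^sub>R y) - t * p y" if "0 \<le> t" for t
        using low[of "s * t" "s *\<^sub>R u"] sublinear_scale[OF p s, of "u + t *\<^sub>R y"] s False that
        by (simp add: field_simps scaleR_add_right)
      then have "D y (s *\<^sub>R u) / s \<le> D y u" by (intro great)
      then show ?thesis using s False by (simp add: field_simps)
    qed
  qed
qed

text \<open>A pointwise minimal sublinear functional is linear, so no domain extension is needed.\<close>

lemma linear_below_sublinear:
  fixes q :: "'v::real_vector \<Rightarrow> real"
  assumes q: "sublinear q"
  shows "\<exists>f. linear f \<and> (\<forall>x. f x \<le> q x)"
proof -
  define A where "A = {p. sublinear p \<and> p \<le> q}"
  have "\<exists>m\<in>A. \<forall>a\<in>A. a \<le> m \<longrightarrow> a = m"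
  \<comment> \<open>Zorn runs on the reversed order: a chain is bounded by its pointwise infimum, or
    by \<open>q\<close> when it is empty.\<close>
  proof (rule predicate_Zorn[where P = "\<lambda>f g. g \<le> f"])
    show "partial_order_on A (relation_of (\<lambda>f g. g \<le> f) A)"
      by (rule partial_order_on_relation_ofI) auto
  next
    fix C assume C: "C \<in> Chains (relation_of (\<lambda>f g. g \<le> f) A)"
    then have CA: "C \<subseteq> A" and chain: "\<And>p p'. p \<in> C \<Longrightarrow> p' \<in> C \<Longrightarrow> p \<le> p' \<or> p' \<le> p"
      by (auto simp: Chains_def relation_of_def)
    show "\<exists>u\<in>A. \<forall>a\<in>C. u \<le> a"
    proof (cases "C = {}")
      case True
      then show ?thesis using q by (auto simp: A_def)
    next
      case False
      have sub: "\<And>p. p \<in> C \<Longrightarrow> sublinear p" and le: "\<And>p. p \<in> C \<Longrightarrow> p \<le> q"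
        using CA by (auto simp: A_def)
      have low: "(\<lambda>x. INF p\<in>C. p x) \<le> p" if "p \<in> C" for p
        using sublinear_INF_chain(2)[OF False sub le chain that] by (auto simp: le_fun_def)
      obtain p where p: "p \<in> C" using False by blast
      have "sublinear (\<lambda>x. INF p\<in>C. p x)"
        by (rule sublinear_INF_chain(1)[OF False sub le chain])
      then have "(\<lambda>x. INF p\<in>C. p x) \<in> A"
        using order_trans[OF low[OF p] le[OF p]] by (simp add: A_def)
      then show ?thesis using low by blast
    qed
  qed
  then obtain p where p: "sublinear p" "p \<le> q"
    and min: "\<And>a. sublinear a \<Longrightarrow> a \<le> p \<Longrightarrow> a = p"
    by (auto simp: A_def intro: order_trans)
  have add: "p (x + y) = p x + p y" for x y
  proof -
    \<comment> \<open>The minorant \<open>d\<close> along \<open>y\<close> cannot lie strictly below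
      the minimal \<open>p\<close>; at \<open>t = 1\<close> this is superadditivity.\<close>
    define d where "d x = (INF t\<in>{0..}. p (x + t *\<^sub>R y) - t * p y)" for x
    have d: "d x \<le> p (x + t *\<^sub>R y) - t * p y" if "0 \<le> t" for t x
      unfolding d_def using that by (rule sublinear_directional(2)[OF p(1)])
    have "sublinear d"
      unfolding d_def by (rule sublinear_directional(1)[OF p(1)])
    moreover have "d \<le> p"
      using d[of 0] by (simp add: le_fun_def)
    ultimately have "d = p" by (rule min)
    then have "p x \<le> p (x + y) - p y" using d[of 1 x] by simp
    then show ?thesis using sublinear_add[OF p(1), of x y] by simp
  qed
  have neg: "p (- x) = - p x" for x
    using add[of x "- x"] sublinear_zero[OF p(1)] by simp
  have "p (t *\<^sub>R x) = t * p x" for t x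
  proof (cases "0 \<le> t")
    case False
    then have "p ((- t) *\<^sub>R x) = - t * p x" using p(1) by (intro sublinear_scale) auto
    then show ?thesis using neg[of "t *\<^sub>R x"] by simp
  qed (use p(1) sublinear_scale in auto)
  then have "linear p" using add by (intro linearI) auto
  then show ?thesis using p(2) by (auto simp: le_fun_def)
qed

text \<open>The infimum \<open>q\<close> of \<open>F x\<close> encodes all demands on
  \<open>f\<close> in one sublinear bound: \<open>(t, c) = (0, 0)\<close> gives
  \<open>f \<le> norm\<close>, \<open>(1, 0)\<close> tested at \<open>- a\<close> gives
  \<open>norm a \<le> f a\<close>, and \<open>(0, c)\<close> tested at \<open>- c\<close> gives
  \<open>0 \<le> f c\<close>. The hypothesis \<open>dist\<close> makes \<open>q\<close>
  finite.\<close>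

lemma norming_functional_nonneg_on_cone:
  fixes a :: "'v::real_normed_vector"
  assumes zero: "0 \<in> C"
    and add: "\<And>c d. c \<in> C \<Longrightarrow> d \<in> C \<Longrightarrow> c + d \<in> C"
    and scale: "\<And>t c. 0 \<le> t \<Longrightarrow> c \<in> C \<Longrightarrow> t *\<^sub>R c \<in> C"
    and dist: "\<And>t c. 0 \<le> t \<Longrightarrow> c \<in> C \<Longrightarrow> t * norm a \<le> norm (t *\<^sub>R a + c)"
  shows "\<exists>f. linear f \<and> (\<forall>x. f x \<le> norm x) \<and> f a = norm a \<and> (\<forall>c\<in>C. 0 \<le> f c)"
proof -
  define F where "F = (\<lambda>x (t, c). norm (x + t *\<^sub>R a + c) - t * norm a)"
  define q where "q = (\<lambda>x. INF z\<in>{0..} \<times> C. F x z)"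
  have ne: "{0::real..} \<times> C \<noteq> {}" using zero by (auto simp: Sigma_empty_iff)
  have "- norm x \<le> F x z" if z_in: "z \<in> {0..} \<times> C" for x z
  proof -
    obtain t c where z: "z = (t, c)" "0 \<le> t" "c \<in> C" using z_in by auto
    have "t * norm a \<le> norm (t *\<^sub>R a + c)" using dist z by simp
    also have "\<dots> \<le> norm (x + t *\<^sub>R a + c) + norm x"
      using norm_triangle_ineq4[of "x + t *\<^sub>R a + c" x] by (simp add: algebra_simps)
    finally show ?thesis by (simp add: F_def z)
  qed
  then have bdd: "bdd_below (F x ` ({0..} \<times> C))" for x by (rule bdd_belowI2)
  have low: "q x \<le> norm (x + t *\<^sub>R a + c) - t * norm a" if "0 \<le> t" "c \<in> C" for x t c
    using cINF_lower[OF bdd, of "(t, c)" x] that by (simp add: q_def F_def)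
  have great: "m \<le> q x"
    if "\<And>t c. 0 \<le> t \<Longrightarrow> c \<in> C \<Longrightarrow> m \<le> norm (x + t *\<^sub>R a + c) - t * norm a" for m x
    unfolding q_def by (rule cINF_greatest[OF ne]) (use that in \<open>auto simp: F_def\<close>)
  have "sublinear q"
    unfolding sublinear_def
  proof (intro conjI allI impI)
    fix x y
    have "q (x + y) - (norm (y + s *\<^sub>R a + d) - s * norm a) \<le> norm (x + t *\<^sub>R a + c) - t * norm a"
      if "0 \<le> s" "d \<in> C" "0 \<le> t" "c \<in> C" for s t c d
    proof -
      have "q (x + y) \<le> norm ((x + t *\<^sub>R a + c) + (y + s *\<^sub>R a + d)) - (t + s) * norm a"
        using low[of "t + s" "c + d" "x + y"] that add by (simp add: algebra_simps)
      also have "\<dots> \<le> norm (x + t *\<^sub>R a + c) + norm (y + s *\<^sub>R a + d) - (t + s) * norm a"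
        using norm_triangle_ineq by simp
      finally show ?thesis by (simp add: algebra_simps)
    qed
    then have "q (x + y) - (norm (y + s *\<^sub>R a + d) - s * norm a) \<le> q x" if "0 \<le> s" "d \<in> C" for s d
      using that by (intro great)
    then have "q (x + y) - q x \<le> q y" by (intro great) (simp add: algebra_simps)
    then show "q (x + y) \<le> q x + q y" by simp
  next
    fix s :: real and x assume s: "0 \<le> s"
    show "q (s *\<^sub>R x) \<le> s * q x"
    proof (cases "s = 0")
      case True
      then show ?thesis using low[of 0 0 0] zero by simp
    next
      case False
      have "q (s *\<^sub>R x) / s \<le> norm (x + t *\<^sub>R a + c) - t * norm a" if "0 \<le> t" "c \<in> C" for t c
      proof -
        have "s *\<^sub>R x + (s * t) *\<^sub>R a + s *\<^sub>R c = s *\<^sub>R (x + t *\<^sub>R a + c)"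
          by (simp add: scaleR_add_right)
        then have "norm (s *\<^sub>R x + (s * t) *\<^sub>R a + s *\<^sub>R c) = s * norm (x + t *\<^sub>R a + c)"
          using s by simp
        then show ?thesis
          using low[of "s * t" "s *\<^sub>R c" "s *\<^sub>R x"] scale[OF s] s False that
          by (simp add: field_simps)
      qed
      then have "q (s *\<^sub>R x) / s \<le> q x" by (intro great)
      then show ?thesis using s False by (simp add: field_simps)
    qed
  qed
  then obtain f where f: "linear f" "\<And>x. f x \<le> q x" using linear_below_sublinear by blast
  have fneg: "f (- x) = - f x" for x using f(1) by (simp add: linear_neg)
  have norm: "f x \<le> norm x" for x
    using f(2)[of x] low[of 0 0 x] zero by simp
  have "f (- a) \<le> - norm a" using f(2)[of "- a"] low[of 1 0 "- a"] zero by simp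
  then have "f a = norm a" using norm[of a] fneg[of a] by simp
  moreover have "0 \<le> f c" if "c \<in> C" for c
    using f(2)[of "- c"] low[of 0 c "- c"] that fneg[of c] by simp
  ultimately show ?thesis using f(1) norm by blast
qed

section \<open>Elementary facts on C*-algebras\<close>

lemma scaleC_zero_left [simp]: "0 *\<^sub>C x = (0::'a::cvec)"
  using scaleC_add_left[of 0 0 x] by simp

lemma scaleC_minus_left [simp]: "(- c) *\<^sub>C x = - (c *\<^sub>C (x::'a::cvec))"
  using scaleC_add_left[of c "- c" x] by (simp add: eq_neg_iff_add_eq_0 add.commute)

lemma scaleC_minus_right [simp]: "c *\<^sub>C (- x) = - (c *\<^sub>C (x::'a::cvec))"
  using scaleC_add_right[of c x "- x"] scaleC_add_right[of c 0 "0::'a"]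
  by (simp add: eq_neg_iff_add_eq_0 add.commute)

lemma scaleC_diff_right: "c *\<^sub>C (x - y) = c *\<^sub>C x - c *\<^sub>C (y::'a::cvec)"
  using scaleC_add_right[of c x "- y"] by simp

lemma cstar_zero [simp]: "cstar (0::'a::cstar_algebra) = 0"
  using cstar_add[of 0 "0::'a"] by simp

lemma cstar_uminus [simp]: "cstar (- x) = - cstar (x::'a::cstar_algebra)"
  using cstar_add[of x "- x"] by (simp add: eq_neg_iff_add_eq_0 add.commute)

lemma cstar_minus: "cstar (x - y) = cstar x - cstar (y::'a::cstar_algebra)"
  using cstar_add[of x "- y"] by simp

lemma cstar_scaleR: "cstar (r *\<^sub>R x) = r *\<^sub>R cstar (x::'a::cstar_algebra)"
  by (simp add: scaleR_scaleC cstar_scaleC)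

lemma scaleR_scaleC_commute: "r *\<^sub>R (c *\<^sub>C x) = c *\<^sub>C (r *\<^sub>R (x::'a::cstar_algebra))"
  by (simp add: scaleR_scaleC scaleC_scaleC mult.commute)

lemma norm_cstar [simp]: "norm (cstar x) = norm (x::'a::cstar_algebra)"
proof -
  have le: "norm y \<le> norm (cstar y)" for y :: 'a
  proof (cases "y = 0")
    case False
    have "(norm y)\<^sup>2 \<le> norm (cstar y) * norm y"
      using cstar_identity[of y] norm_mult_ineq[of "cstar y" y] by simp
    then show ?thesis using False by (simp add: power2_eq_square)
  qed simp
  show ?thesis using le[of x] le[of "cstar x"] by (simp add: cstar_cstar)
qed

lemma bounded_linear_cstar: "bounded_linear (cstar :: 'a::cstar_algebra \<Rightarrow> 'a)"
  by (rule bounded_linear_intro[where K = 1]) (simp_all add: cstar_add cstar_scaleR)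

lemma norm_selfadjoint_square: "cstar x = x \<Longrightarrow> norm (x * x) = (norm (x::'a::cstar_algebra))\<^sup>2"
  using cstar_identity[of x] by simp

lemma cstar_mult_eq_0: "cstar x * x = 0 \<Longrightarrow> (x::'a::cstar_algebra) = 0"
  using cstar_identity[of x] by simp

section \<open>Square roots without a spectrum\<close>

text \<open>The iteration converges to \<open>1 - sqrt (1 - x)\<close> for \<open>norm x \<le> 1\<close>, boundary
  included: its increments are dominated by those of the real iteration with \<open>x = 1\<close>.\<close>

primrec sqrt_iter :: "'a::real_normed_algebra \<Rightarrow> nat \<Rightarrow> 'a" where
  "sqrt_iter x 0 = 0"
| "sqrt_iter x (Suc n) = (1/2) *\<^sub>R (x + sqrt_iter x n * sqrt_iter x n)"

lemma sqrt_iter_commute: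
  assumes "z * x = x * z"
  shows "z * sqrt_iter x n = sqrt_iter x n * z"
proof (induction n)
  case (Suc n)
  have "z * (sqrt_iter x n * sqrt_iter x n) = sqrt_iter x n * sqrt_iter x n * z"
    by (metis Suc mult.assoc)
  then show ?case using assms by (simp add: algebra_simps)
qed simp

lemma sqrt_iter_one_bounds: "0 \<le> sqrt_iter (1::real) n \<and> sqrt_iter (1::real) n \<le> 1"
proof (induction n)
  case (Suc n)
  then have "sqrt_iter (1::real) n * sqrt_iter 1 n \<le> 1" by (intro mult_le_one) auto
  with Suc show ?case by simp
qed simp

lemma norm_sqrt_iter:
  assumes "norm x \<le> 1"
  shows "norm (sqrt_iter x n) \<le> sqrt_iter 1 n"
proof (induction n)
  case (Suc n)
  have "norm (x + sqrt_iter x n * sqrt_iter x n) \<le> norm x + norm (sqrt_iter x n * sqrt_iter x n)"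
    by (rule norm_triangle_ineq)
  also have "\<dots> \<le> 1 + sqrt_iter 1 n * sqrt_iter 1 n"
    using Suc sqrt_iter_one_bounds[of n] assms
    by (intro add_mono order_trans[OF norm_mult_ineq] mult_mono) auto
  finally show ?case by simp
qed simp

text \<open>Iterates of one \<open>x\<close> commute, so \<open>s * s - r * r\<close> factors as
  \<open>(s + r) * (s - r)\<close>, and each factor is dominated by its real counterpart at
  \<open>x = 1\<close>.\<close>

lemma norm_sqrt_iter_increment:
  assumes "norm x \<le> 1"
  shows "norm (sqrt_iter x (Suc n) - sqrt_iter x n) \<le> sqrt_iter 1 (Suc n) - sqrt_iter 1 n"
proof (induction n)
  case 0
  then show ?case using assms by simp
next
  case (Suc n)
  define r s where "r = sqrt_iter x n" "s = sqrt_iter x (Suc n)"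
  define \<rho> \<sigma> where "\<rho> = sqrt_iter (1::real) n" "\<sigma> = sqrt_iter (1::real) (Suc n)"
  have \<sigma>_eq: "\<sigma> = (1/2) *\<^sub>R (1 + \<rho> * \<rho>)" by (simp add: \<rho>_\<sigma>_def)
  have "r * s = s * r"
    unfolding r_s_def by (intro sqrt_iter_commute[symmetric] sqrt_iter_commute) simp
  then have "s * s - r * r = (s + r) * (s - r)" by (simp add: algebra_simps)
  moreover have "sqrt_iter x (Suc (Suc n)) - sqrt_iter x (Suc n) = (1/2) *\<^sub>R (s * s - r * r)"
    unfolding sqrt_iter.simps(2)[of x "Suc n"] sqrt_iter.simps(2)[of x n]
    by (simp add: r_s_def algebra_simps)
  ultimately have "norm (sqrt_iter x (Suc (Suc n)) - sqrt_iter x (Suc n)) = norm ((s + r) * (s - r)) / 2"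
    by simp
  also have "\<dots> \<le> (\<sigma> + \<rho>) * (\<sigma> - \<rho>) / 2"
    using norm_sqrt_iter[OF assms, of n] norm_sqrt_iter[OF assms, of "Suc n"] Suc
      sqrt_iter_one_bounds[of n] sqrt_iter_one_bounds[of "Suc n"]
    unfolding r_s_def[symmetric] \<rho>_\<sigma>_def[symmetric]
    by (intro divide_right_mono order_trans[OF norm_mult_ineq] mult_mono
        order_trans[OF norm_triangle_ineq] add_mono) auto
  also have "\<dots> = sqrt_iter 1 (Suc (Suc n)) - sqrt_iter 1 (Suc n)"
  proof -
    have "(\<sigma> + \<rho>) * (\<sigma> - \<rho>) = \<sigma> * \<sigma> - \<rho> * \<rho>" by (simp add: algebra_simps)
    moreover have "\<rho> * \<rho> = 2 * \<sigma> - 1" using \<sigma>_eq by simp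
    ultimately show ?thesis
      unfolding sqrt_iter.simps(2)[of 1 "Suc n"] \<rho>_\<sigma>_def[symmetric] by simp
  qed
  finally show ?case .
qed

lemma norm_sqrt_iter_diff:
  assumes "norm x \<le> 1" "n \<le> m"
  shows "norm (sqrt_iter x m - sqrt_iter x n) \<le> sqrt_iter 1 m - sqrt_iter 1 n"
  using assms(2)
proof (induction rule: dec_induct)
  case (step k)
  then show ?case
    using norm_sqrt_iter_increment[OF assms(1), of k]
      norm_triangle_ineq[of "sqrt_iter x (Suc k) - sqrt_iter x k" "sqrt_iter x k - sqrt_iter x n"]
    by (simp del: sqrt_iter.simps)
qed simp

text \<open>The real sequence is increasing and bounded, hence Cauchy, and it dominates all
  differences. A contraction argument would lose its margin at \<open>norm x = 1\<close>.\<close>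

lemma sqrt_iter_convergent:
  fixes x :: "'a::{real_normed_algebra,banach}"
  assumes "norm x \<le> 1"
  shows "convergent (sqrt_iter x)"
proof -
  have "incseq (sqrt_iter (1::real))"
    using norm_sqrt_iter_diff[of "1::real"] by (intro incseq_SucI) (smt (verit) norm_ge_zero le_Suc_eq norm_one order_refl)
  then have "convergent (sqrt_iter (1::real))"
    using sqrt_iter_one_bounds by (metis incseq_convergent convergentI)
  then have cau: "Cauchy (sqrt_iter (1::real))" by (rule convergent_Cauchy)
  have "Cauchy (sqrt_iter x)"
  proof (rule metric_CauchyI)
    fix \<epsilon> :: real assume "\<epsilon> > 0"
    then obtain M where M: "\<And>m n. m \<ge> M \<Longrightarrow> n \<ge> M \<Longrightarrow> dist (sqrt_iter (1::real) m) (sqrt_iter 1 n) < \<epsilon>"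
      using metric_CauchyD[OF cau] by blast
    have "dist (sqrt_iter x m) (sqrt_iter x n) \<le> dist (sqrt_iter (1::real) m) (sqrt_iter 1 n)" for m n
    proof (cases "n \<le> m")
      case True
      then show ?thesis
        using norm_sqrt_iter_diff[OF assms True] by (simp add: dist_norm)
    next
      case False
      then show ?thesis
        using norm_sqrt_iter_diff[OF assms, of m n] by (simp add: dist_norm norm_minus_commute)
    qed
    then show "\<exists>M. \<forall>m\<ge>M. \<forall>n\<ge>M. dist (sqrt_iter x m) (sqrt_iter x n) < \<epsilon>"
      using M le_less_trans by blast
  qed
  then show ?thesis by (rule Cauchy_convergent)
qed

text \<open>The equation says \<open>(1 - r)\<^sup>2 = 1 - x\<close> without mentioning a unit. The
  commutation clause, inherited from the iterates, stands in for functional calculus.\<close>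

lemma selfadjoint_sqrt_exists:
  fixes x :: "'a::cstar_algebra"
  assumes "norm x \<le> 1" "cstar x = x"
  obtains r where "cstar r = r" "norm r \<le> 1" "2 *\<^sub>R r = x + r * r"
    "\<And>z. z * x = x * z \<Longrightarrow> z * r = r * z"
proof -
  obtain r where r: "sqrt_iter x \<longlonglongrightarrow> r"
    using sqrt_iter_convergent[OF assms(1)] by (auto simp: convergent_def)
  have "cstar (sqrt_iter x n) = sqrt_iter x n" for n
    by (induction n) (simp_all add: cstar_scaleR cstar_add cstar_mult assms)
  then have sa: "cstar r = r"
    using bounded_linear.tendsto[OF bounded_linear_cstar r] r by (simp add: LIMSEQ_unique)
  have "norm (sqrt_iter x n) \<le> 1" for n
    using norm_sqrt_iter[OF assms(1), of n] sqrt_iter_one_bounds[of n] by simp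
  then have norm: "norm r \<le> 1"
    using tendsto_norm[OF r] by (intro LIMSEQ_le_const2) auto
  have "(\<lambda>n. sqrt_iter x (Suc n)) \<longlonglongrightarrow> (1/2) *\<^sub>R (x + r * r)"
    unfolding sqrt_iter.simps by (intro tendsto_intros r)
  then have "r = (1/2) *\<^sub>R (x + r * r)"
    using LIMSEQ_Suc[OF r] LIMSEQ_unique by blast
  then have "2 *\<^sub>R r = 2 *\<^sub>R (1/2) *\<^sub>R (x + r * r)" by simp
  then have eq: "2 *\<^sub>R r = x + r * r" by simp
  have comm: "z * r = r * z" if "z * x = x * z" for z
  proof -
    have "(\<lambda>n. z * sqrt_iter x n) \<longlonglongrightarrow> z * r" "(\<lambda>n. sqrt_iter x n * z) \<longlonglongrightarrow> r * z"
      by (intro tendsto_intros r)+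
    then show ?thesis using sqrt_iter_commute[OF that] by (simp add: LIMSEQ_unique)
  qed
  show ?thesis using sa norm eq comm by (rule that)
qed

section \<open>Positivity in unital C*-algebras\<close>

locale unital_cstar =
  fixes e :: "'a::cstar_algebra"
  assumes e_left [simp]: "e * x = x" and e_right [simp]: "x * e = x"
begin

lemma cstar_e [simp]: "cstar e = e"
  by (metis cstar_cstar cstar_mult e_left)

lemma norm_e_le: "norm e \<le> 1"
  using norm_selfadjoint_square[of e] by (auto simp: power2_eq_square)

text \<open>For a self-adjoint \<open>h\<close> the norm bound puts the spectrum into \<open>[0, 2 T]\<close>.\<close>

definition pos :: "'a \<Rightarrow> bool" where
  "pos h \<longleftrightarrow> cstar h = h \<and> (\<exists>T\<ge>0. norm (T *\<^sub>R e - h) \<le> T)"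

lemma pos_selfadjoint: "pos h \<Longrightarrow> cstar h = h"
  by (simp add: pos_def)

lemma posI: "cstar h = h \<Longrightarrow> 0 \<le> T \<Longrightarrow> norm (T *\<^sub>R e - h) \<le> T \<Longrightarrow> pos h"
  by (auto simp: pos_def)

lemma pos_add:
  assumes "pos h" "pos g"
  shows "pos (h + g)"
proof -
  obtain S T where S: "S \<ge> 0" "norm (S *\<^sub>R e - h) \<le> S" and T: "T \<ge> 0" "norm (T *\<^sub>R e - g) \<le> T"
    using assms by (auto simp: pos_def)
  have "norm ((S *\<^sub>R e - h) + (T *\<^sub>R e - g)) \<le> S + T"
    using S T by (intro norm_triangle_le) simp
  then show ?thesis
    using S T pos_selfadjoint[OF assms(1)] pos_selfadjoint[OF assms(2)]
    by (intro posI[of _ "S + T"]) (simp_all add: cstar_add algebra_simps)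
qed

lemma pos_scaleR:
  assumes "pos h" "0 \<le> t"
  shows "pos (t *\<^sub>R h)"
proof -
  obtain S where S: "S \<ge> 0" "norm (S *\<^sub>R e - h) \<le> S"
    using assms by (auto simp: pos_def)
  have "(t * S) *\<^sub>R e - t *\<^sub>R h = t *\<^sub>R (S *\<^sub>R e - h)" by (simp add: algebra_simps)
  then show ?thesis
    using S assms(2) pos_selfadjoint[OF assms(1)]
    by (intro posI[of _ "t * S"]) (simp_all add: cstar_scaleR mult_left_mono)
qed

lemma pos_zero: "pos 0"
  by (rule posI[of _ 0]) simp_all

section \<open>Square roots and monotonicity of the norm\<close>

lemma pos_norm_minus:
  assumes "cstar h = h"
  shows "pos (norm h *\<^sub>R e - h)"
  using assms by (intro posI[of _ "norm h"]) (simp_all add: cstar_minus cstar_scaleR)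

text \<open>Rescaling by \<open>T\<close> makes the norm of \<open>x = e - h / T\<close> at most 1,
  and \<open>(e - r)\<^sup>2 = h / T\<close>. The root is positive because
  \<open>norm r \<le> 1\<close>.\<close>

lemma pos_sqrt:
  assumes "pos h"
  obtains k where "pos k" "k * k = h" "\<And>z. z * h = h * z \<Longrightarrow> z * k = k * z"
proof -
  obtain T where T: "T \<ge> 0" "norm (T *\<^sub>R e - h) \<le> T" using assms by (auto simp: pos_def)
  show ?thesis
  proof (cases "T = 0")
    case True
    then show ?thesis using that[of 0] T pos_zero by simp
  next
    case False
    then have T0: "T > 0" using T by simp
    define x where "x = e - (1/T) *\<^sub>R h"
    have "x = (1/T) *\<^sub>R (T *\<^sub>R e - h)" using T0 by (simp add: x_def algebra_simps)
    then have "norm x \<le> 1" using T T0 by simp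
    moreover have "cstar x = x"
      using pos_selfadjoint[OF assms] by (simp add: x_def cstar_minus cstar_scaleR)
    ultimately obtain r where r: "cstar r = r" "norm r \<le> 1" "2 *\<^sub>R r = x + r * r"
      and comm: "\<And>z. z * x = x * z \<Longrightarrow> z * r = r * z"
      using selfadjoint_sqrt_exists by blast
    define k where "k = sqrt T *\<^sub>R (e - r)"
    have "pos k"
      using r T0 by (intro posI[of _ "sqrt T"])
        (simp_all add: k_def cstar_scaleR cstar_minus scaleR_diff_right)
    moreover have "k * k = h"
    proof -
      have "(e - r) * (e - r) = e - (2 *\<^sub>R r - r * r)" by (simp add: algebra_simps scaleR_2)
      also have "\<dots> = (1/T) *\<^sub>R h" using r(3) by (simp add: x_def)
      finally show ?thesis using T0 by (simp add: k_def)
    qed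
    moreover have "z * k = k * z" if "z * h = h * z" for z
    proof -
      have "z * r = r * z" using that by (intro comm) (simp add: x_def algebra_simps)
      then show ?thesis by (simp add: k_def algebra_simps)
    qed
    ultimately show ?thesis by (rule that)
  qed
qed

text \<open>If \<open>k\<close>, \<open>m\<close> are commuting self-adjoint elements with \<open>k\<^sup>2 + m\<^sup>2 = M\<close>, then
  \<open>u = k + i m\<close> is \<open>sqrt M\<close> times a unitary, and \<open>m\<close> is the imaginary part of \<open>u\<close>.\<close>

lemma norm_le_of_square_sum:
  assumes k: "cstar k = k" and m: "cstar m = m" and comm: "k * m = m * k"
    and sum: "k * k + m * m = M *\<^sub>R e" and M: "0 \<le> M"
  shows "norm (m * m) \<le> M"
proof -
  define u where "u = k + \<i> *\<^sub>C m"
  have star: "cstar u = k - \<i> *\<^sub>C m"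
    by (simp add: u_def cstar_add cstar_scaleC k m)
  have "cstar u * u = k * k + m * m"
    unfolding star unfolding u_def
    by (simp add: algebra_simps scaleC_mult_left scaleC_mult_right scaleC_scaleC scaleC_diff_right comm scaleC_one)
  then have "(norm u)\<^sup>2 = M * norm e"
    using cstar_identity[of u] sum M by simp
  also have "\<dots> \<le> M" using norm_e_le M by (rule mult_left_le)
  finally have "(norm u)\<^sup>2 \<le> M" .
  then have u: "norm u \<le> sqrt M" by (simp add: real_le_rsqrt)
  have "u - cstar u = (2 * \<i>) *\<^sub>C m"
    unfolding star unfolding u_def by (simp flip: scaleC_add_left)
  then have "2 * norm m = norm (u - cstar u)" by (simp add: norm_scaleC)
  also have "\<dots> \<le> 2 * sqrt M"
    using norm_triangle_ineq4[of u "cstar u"] u by simp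
  finally have "(norm m)\<^sup>2 \<le> (sqrt M)\<^sup>2" by (intro power_mono) auto
  then show ?thesis using norm_selfadjoint_square[OF m] M by simp
qed

text \<open>With \<open>m\<close> the root of \<open>T *\<^sub>R e - k * k\<close>, the squares of
  \<open>k\<close> and \<open>m\<close> add up to \<open>T *\<^sub>R e\<close>, and the resulting
  estimate of \<open>m * m\<close> is the defining inequality of \<open>pos\<close> for
  \<open>k * k\<close>.\<close>

lemma pos_square:
  assumes k: "cstar k = k"
  shows "pos (k * k)"
proof -
  define T where "T = norm (k * k)"
  have "pos (T *\<^sub>R e - k * k)"
    unfolding T_def by (rule pos_norm_minus) (simp add: cstar_mult k)
  then obtain m where m: "pos m" "m * m = T *\<^sub>R e - k * k"
    and comm: "\<And>z. z * (T *\<^sub>R e - k * k) = (T *\<^sub>R e - k * k) * z \<Longrightarrow> z * m = m * z"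
    using pos_sqrt by blast
  have "k * m = m * k" by (rule comm) (simp add: algebra_simps)
  then have "norm (m * m) \<le> T"
    using k m pos_selfadjoint[OF m(1)] by (intro norm_le_of_square_sum[of k]) (simp_all add: T_def)
  then show ?thesis
    using m(2) by (intro posI[of _ T]) (simp_all add: cstar_mult k T_def)
qed

text \<open>The roots of \<open>h\<close> and of \<open>M *\<^sub>R e - h\<close> commute, since
  each commutes with whatever commutes with its square, and their squares add up to
  \<open>M *\<^sub>R e\<close>.\<close>

lemma norm_le_of_pos_minus:
  assumes h: "pos h" and M: "pos (M *\<^sub>R e - h)" "0 \<le> M"
  shows "norm h \<le> M"
proof -
  obtain m where m: "pos m" "m * m = h" and mcomm: "\<And>z. z * h = h * z \<Longrightarrow> z * m = m * z"
    using pos_sqrt[OF h] by blast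
  obtain k where k: "pos k" "k * k = M *\<^sub>R e - h"
    and kcomm: "\<And>z. z * (M *\<^sub>R e - h) = (M *\<^sub>R e - h) * z \<Longrightarrow> z * k = k * z"
    using pos_sqrt[OF M(1)] by blast
  have "h * k = k * h" by (rule kcomm) (simp add: algebra_simps)
  then have "k * m = m * k" by (intro mcomm) simp
  then have "norm (m * m) \<le> M"
    using m k pos_selfadjoint M(2) by (intro norm_le_of_square_sum[of k]) auto
  then show ?thesis using m by simp
qed

lemma norm_mono:
  assumes "pos h" "pos g"
  shows "norm h \<le> norm (h + g)"
proof -
  have "pos (norm (h + g) *\<^sub>R e - (h + g))"
    using assms by (intro pos_norm_minus) (simp add: cstar_add pos_selfadjoint)
  then have "pos (norm (h + g) *\<^sub>R e - (h + g) + g)" using assms(2) by (rule pos_add)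
  then show ?thesis using assms(1) by (intro norm_le_of_pos_minus) simp_all
qed

lemma pos_antisym:
  assumes "pos h" "pos (- h)"
  shows "h = 0"
  using norm_mono[OF assms] by simp

lemma pos_mult_commuting:
  assumes "pos h" "pos g" "h * g = g * h"
  shows "pos (h * g)"
proof -
  obtain k where k: "pos k" "k * k = h" and kcomm: "\<And>z. z * h = h * z \<Longrightarrow> z * k = k * z"
    using pos_sqrt[OF assms(1)] by blast
  obtain m where m: "pos m" "m * m = g" and mcomm: "\<And>z. z * g = g * z \<Longrightarrow> z * m = m * z"
    using pos_sqrt[OF assms(2)] by blast
  have "g * k = k * g" using assms(3) by (intro kcomm) simp
  then have km: "k * m = m * k" by (intro mcomm) simp
  then have "h * g = (k * m) * (k * m)"
    using k m by (metis mult.assoc)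
  moreover have "cstar (k * m) = k * m"
    using km pos_selfadjoint[OF k(1)] pos_selfadjoint[OF m(1)] by (simp add: cstar_mult)
  ultimately show ?thesis using pos_square by metis
qed

section \<open>Kaplansky's theorem: \<open>cstar b * b\<close> is positive\<close>

text \<open>The powers of \<open>T + b b*\<close> and of \<open>T + b* b\<close> have the same growth rate, which for a
  self-adjoint element is its norm.\<close>

lemma pos_neg_swap:
  assumes "pos (- (cstar b * b))"
  shows "pos (- (b * cstar b))"
proof -
  obtain T where T: "T \<ge> 0" "norm (T *\<^sub>R e + cstar b * b) \<le> T" using assms by (auto simp: pos_def)
  define X where "X = T *\<^sub>R e + cstar b * b"
  define Y where "Y = T *\<^sub>R e + b * cstar b"
  define pw where "pw z n = ((*) z ^^ n) e" for z :: 'a and n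
  have pw0: "pw z 0 = e" and pwS: "pw z (Suc n) = z * pw z n" for z n
    by (simp_all add: pw_def)
  have pw_add: "pw z (m + n) = pw z m * pw z n" for z m n
    by (induction m) (simp_all add: pw0 pwS mult.assoc)
  \<comment> \<open>\<open>cstar b\<close> intertwines \<open>Y\<close> and \<open>X\<close>, so the
    powers of \<open>Y\<close> obey a recursion whose extra term involves only powers of
    \<open>X\<close>.\<close>
  have "b * cstar b * pw Y n = b * pw X n * cstar b" for n
  proof -
    have "cstar b * pw Y n = pw X n * cstar b"
    proof (induction n)
      case (Suc n)
      have "cstar b * (Y * pw Y n) = X * (cstar b * pw Y n)"
        by (simp add: X_def Y_def algebra_simps)
      with Suc show ?case by (simp add: pwS mult.assoc)
    qed (simp add: pw0)
    then show ?thesis by (simp add: mult.assoc)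
  qed
  then have step: "pw Y (Suc n) = T *\<^sub>R pw Y n + b * pw X n * cstar b" for n
    by (simp add: pwS, simp add: Y_def algebra_simps)
  have X: "norm (pw X n) \<le> T ^ n" for n
  proof (induction n)
    case (Suc n)
    then show ?case
      using T unfolding pwS power_Suc X_def[symmetric]
      by (intro order_trans[OF norm_mult_ineq] mult_mono) auto
  qed (simp add: pw0 norm_e_le)
  have Ysa: "cstar Y = Y" by (simp add: Y_def cstar_add cstar_scaleR cstar_mult cstar_cstar)
  have pwsa: "cstar (pw Y n) = pw Y n" for n
  proof (induction n)
    case (Suc n)
    have "pw Y n * Y = pw Y (n + Suc 0)" unfolding pw_add by (simp add: pw0 pwS)
    then show ?case using Suc Ysa by (simp add: pwS cstar_mult)
  qed (simp add: pw0)
  \<comment> \<open>At powers of two the norm is exact: each doubling is the C*-identity for a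
    self-adjoint element.\<close>
  have Y2: "norm (pw Y (2 ^ j)) = norm Y ^ (2 ^ j)" for j
  proof (induction j)
    case (Suc j)
    then show ?case
      using norm_selfadjoint_square[OF pwsa, of "2 ^ j"]
      by (simp add: mult_2 pw_add power_add power2_eq_square)
  qed (simp add: pw0 pwS)
  have "norm Y \<le> T"
  proof (cases "T = 0")
    case True
    then have "cstar b * b = 0" using T by simp
    then have "b = 0" by (rule cstar_mult_eq_0)
    then show ?thesis using True by (simp add: Y_def)
  next
    case False
    then have T0: "T > 0" using T by simp
    \<comment> \<open>Dividing the recursion by \<open>T ^ Suc n\<close> turns its extra term, at
      most \<open>T ^ n * (norm b)\<^sup>2\<close>, into the constant \<open>C\<close>. Hence the
      bound exceeds \<open>T ^ n\<close> only by a factor linear in \<open>n\<close>.\<close>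
    define C where "C = (norm b)\<^sup>2 / T"
    have C: "norm (pw Y n) \<le> T ^ n * (1 + real n * C)" for n
    proof (induction n)
      case (Suc n)
      have "norm (b * pw X n * cstar b) \<le> norm b * norm (pw X n) * norm b"
        using norm_mult_ineq[of "b * pw X n" "cstar b"] norm_mult_ineq[of b "pw X n"]
        by (smt (verit) norm_cstar mult_right_mono norm_ge_zero)
      also have "\<dots> \<le> norm b * T ^ n * norm b"
        by (intro mult_right_mono mult_left_mono X) auto
      also have "\<dots> = T ^ Suc n * C" using T0 by (simp add: C_def power2_eq_square)
      finally have "norm (pw Y (Suc n)) \<le> T * norm (pw Y n) + T ^ Suc n * C"
        unfolding step using T0 by (intro norm_triangle_le) simp
      also have "\<dots> \<le> T * (T ^ n * (1 + real n * C)) + T ^ Suc n * C"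
        using Suc T0 by simp
      finally show ?case by (simp add: algebra_simps)
    qed (simp add: pw0 norm_e_le)
    show ?thesis
    proof (rule ccontr)
      assume "\<not> norm Y \<le> T"
      then have Y: "norm Y > T" by simp
      define q where "q = T / norm Y"
      have q: "0 < q" "q < 1" using T0 less_trans[OF T0 Y] Y by (simp_all add: q_def)
      have "(\<lambda>n. q ^ n + (real n * q ^ n) * C) \<longlonglongrightarrow> 0 + 0 * C"
        using q by (intro tendsto_intros LIMSEQ_realpow_zero powser_times_n_limit_0) auto
      then have "eventually (\<lambda>n. q ^ n + (real n * q ^ n) * C < 1) sequentially"
        by (rule order_tendstoD) simp
      then obtain N where N: "\<And>n. n \<ge> N \<Longrightarrow> q ^ n + (real n * q ^ n) * C < 1"
        by (auto simp: eventually_sequentially)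
      \<comment> \<open>An exponent beyond \<open>N\<close> that is a power of two, where the norm
        of \<open>pw Y n\<close> is known exactly.\<close>
      define n :: nat where "n = 2 ^ N"
      have "norm Y ^ n \<le> T ^ n * (1 + real n * C)" using C[of n] Y2[of N] by (simp add: n_def)
      then have "1 \<le> q ^ n * (1 + real n * C)"
        using less_trans[OF T0 Y] by (simp add: q_def power_divide pos_le_divide_eq)
      moreover have "N \<le> n" unfolding n_def by (simp add: less_imp_le)
      ultimately show False using N[of n] by (simp add: algebra_simps)
    qed
  qed
  then show ?thesis
    using T by (intro posI[of _ T]) (simp_all add: Y_def cstar_mult cstar_cstar)
qed

text \<open>Up to sign, \<open>u\<close> and \<open>v\<close> are twice the real and imaginary parts
  of \<open>b\<close>. In \<open>u * u + v * v\<close> the terms \<open>b * b\<close> and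
  \<open>cstar b * cstar b\<close> cancel.\<close>

lemma pos_real_imag_squares: "pos (cstar b * b + b * cstar b)"
proof -
  define u v where "u = b + cstar b" "v = \<i> *\<^sub>C (b - cstar b)"
  have "cstar u = u" by (simp add: u_v_def cstar_add cstar_cstar add.commute)
  moreover have "cstar v = v"
    by (simp add: u_v_def cstar_minus cstar_scaleC cstar_cstar scaleC_diff_right)
  ultimately have uv: "pos (u * u + v * v)" by (intro pos_add pos_square)
  have "v * v = - ((b - cstar b) * (b - cstar b))"
    by (simp add: u_v_def scaleC_mult_left scaleC_mult_right scaleC_scaleC scaleC_one)
  then have "u * u + v * v = 2 *\<^sub>R (cstar b * b + b * cstar b)"
    by (simp add: u_v_def algebra_simps scaleR_2)
  then show ?thesis using pos_scaleR[OF uv, of "1/2"] by simp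
qed

text \<open>By \<open>pos_neg_swap\<close> also \<open>- (b * cstar b)\<close> is positive. Adding
  it to the sum in \<open>pos_real_imag_squares\<close> leaves \<open>cstar b * b\<close>, which is
  then positive together with its negative.\<close>

lemma pos_neg_cstar_mult_eq_0:
  assumes "pos (- (cstar b * b))"
  shows "b = 0"
proof -
  have "pos ((cstar b * b + b * cstar b) + - (b * cstar b))"
    by (intro pos_add pos_real_imag_squares pos_neg_swap assms)
  then have "cstar b * b = 0" using assms by (intro pos_antisym) simp_all
  then show ?thesis by (rule cstar_mult_eq_0)
qed

text \<open>With \<open>h = b* b\<close>, \<open>k = \<bar>h\<bar>\<close> and \<open>n = k - h\<close>, twice the negative part of \<open>h\<close>, the
  element \<open>-(b n)* (b n) = - n h n = n\<^sup>2 k\<close> is positive, hence \<open>b n = 0\<close>.\<close>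

theorem pos_cstar_mult: "pos (cstar b * b)"
proof -
  define h where "h = cstar b * b"
  have h: "cstar h = h" by (simp add: h_def cstar_mult cstar_cstar)
  obtain k where k: "pos k" "k * k = h * h"
    and comm: "\<And>z. z * (h * h) = (h * h) * z \<Longrightarrow> z * k = k * z"
    using pos_sqrt[OF pos_square[OF h]] by blast
  have hk: "h * k = k * h" by (rule comm) (simp add: mult.assoc)
  define n where "n = k - h"
  have n: "cstar n = n" using h pos_selfadjoint[OF k(1)] by (simp add: n_def cstar_minus)
  have nk: "n * k = k * n" using hk by (simp add: n_def algebra_simps)
  have nh: "n * h = - (n * k)" using k(2) hk by (simp add: n_def algebra_simps)
  have nn: "n * n = 2 *\<^sub>R (n * k)"
    using nh by (simp add: n_def algebra_simps scaleR_2)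
  have hn: "h * n = - (n * k)" using nh hk by (simp add: n_def algebra_simps)
  have star: "cstar (b * n) * (b * n) = - (n * n * k)"
  proof -
    have "cstar (b * n) * (b * n) = n * (h * n)" by (simp add: cstar_mult n h_def mult.assoc)
    then show ?thesis by (simp add: hn mult.assoc)
  qed
  have "pos (n * n * k)"
  proof (rule pos_mult_commuting)
    show "n * n * k = k * (n * n)" using nk by (metis mult.assoc)
  qed (use n k pos_square in auto)
  then have "b * n = 0" by (intro pos_neg_cstar_mult_eq_0) (simp add: star)
  \<comment> \<open>This says \<open>n * k = 0\<close>, hence \<open>n * n = 0\<close> and
    \<open>n = 0\<close>: \<open>h\<close> equals the positive root \<open>k\<close>.\<close>
  then have "h * n = 0" by (simp add: h_def mult.assoc)
  then have "cstar n * n = 0" using hn nn n by simp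
  then have "k = h" using cstar_mult_eq_0[of n] by (simp add: n_def)
  then show ?thesis using k by (simp add: h_def)
qed

end

section \<open>The multiplier algebra\<close>

lemma bounded_linear_scaleC: "bounded_linear (\<lambda>x::'a::cstar_algebra. c *\<^sub>C x)"
  by (rule bounded_linear_intro[where K = "cmod c"])
    (simp_all add: scaleC_add_right scaleR_scaleC_commute norm_scaleC)

lift_definition scaleC_blinfun :: "complex \<Rightarrow> 'a::cstar_algebra \<Rightarrow>\<^sub>L 'a" is "\<lambda>c x. c *\<^sub>C x"
  by (rule bounded_linear_scaleC)

declare scaleC_blinfun.rep_eq [simp]

lifting_forget blinfun.lifting

text \<open>A multiplier is stored together with its adjoint, which makes the involution a swap.\<close>

typedef (overloaded) 'a multiplier =
  "{TS :: ('a::cstar_algebra \<Rightarrow>\<^sub>L 'a) \<times> ('a \<Rightarrow>\<^sub>L 'a).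
      \<forall>x y. cstar (blinfun_apply (fst TS) x) * y = cstar x * blinfun_apply (snd TS) y}"
  morphisms mult_pair Abs_multiplier
  by (rule exI[of _ 0]) simp

setup_lifting type_definition_multiplier

lift_definition app :: "'a::cstar_algebra multiplier \<Rightarrow> ('a \<Rightarrow>\<^sub>L 'a)" is fst .
lift_definition adj :: "'a::cstar_algebra multiplier \<Rightarrow> ('a \<Rightarrow>\<^sub>L 'a)" is snd .

lemma app_adj: "cstar (app m x) * y = cstar x * adj m y"
  by transfer blast

lemma adj_app: "cstar (adj m x) * y = cstar x * app m y"
  using arg_cong[OF app_adj[of m y x], of cstar] by (simp add: cstar_mult cstar_cstar)

text \<open>Testing with \<open>y = a - b\<close> reduces this to the C*-identity; it replaces
  cancelling against a unit.\<close>

lemma cstar_mult_cancel: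
  assumes "\<And>y. cstar y * a = cstar y * (b::'a::cstar_algebra)"
  shows "a = b"
  using assms[of "a - b"] cstar_mult_eq_0[of "a - b"] by (simp add: right_diff_distrib)

text \<open>The adjoint is determined by the operator, because \<open>app_adj\<close> fixes all
  products \<open>cstar x * adj m y\<close>. Identities of multipliers can therefore be checked on
  \<open>app\<close> alone.\<close>

lemma multiplier_eqI:
  assumes "\<And>x. app m x = app n x"
  shows "m = n"
proof -
  have "adj m = adj n"
    by (rule blinfun_eqI, rule cstar_mult_cancel) (simp add: assms flip: app_adj)
  moreover have "app m = app n" using assms by (rule blinfun_eqI)
  ultimately show ?thesis by transfer (simp add: prod_eq_iff)
qed

text \<open>A \<open>blinfun\<close> is only real-linear by its type; having an adjoint forces
  complex linearity.\<close>

lemma app_scaleC: "app m (c *\<^sub>C x) = c *\<^sub>C app m x"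
  by (rule cstar_mult_cancel) (simp add: scaleC_mult_right flip: adj_app)

text \<open>The C*-identity at \<open>adj m y\<close> trades the adjoint for \<open>app m\<close>.
  Thus the norm of \<open>app\<close> controls both components, on which completeness and the
  C*-identity of multipliers rest.\<close>

lemma norm_adj_le: "norm (adj m) \<le> norm (app m)"
proof (rule norm_blinfun_bound)
  fix y
  show "norm (adj m y) \<le> norm (app m) * norm y"
  proof (cases "adj m y = 0")
    case False
    have "(norm (adj m y))\<^sup>2 = norm (cstar y * app m (adj m y))"
      using cstar_identity[of "adj m y"] adj_app[of m y "adj m y"] by simp
    also have "\<dots> \<le> norm y * (norm (app m) * norm (adj m y))"
      by (intro order_trans[OF norm_mult_ineq] mult_mono norm_blinfun) auto
    finally show ?thesis using False by (simp add: power2_eq_square mult_ac)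
  qed simp
qed simp

instantiation multiplier :: (cstar_algebra) real_normed_algebra
begin

lift_definition zero_multiplier :: "'a multiplier" is "(0, 0)" by simp
lift_definition plus_multiplier :: "'a multiplier \<Rightarrow> 'a multiplier \<Rightarrow> 'a multiplier"
  is "\<lambda>m n. (fst m + fst n, snd m + snd n)"
  by (simp add: blinfun.add_left cstar_add algebra_simps)
lift_definition minus_multiplier :: "'a multiplier \<Rightarrow> 'a multiplier \<Rightarrow> 'a multiplier"
  is "\<lambda>m n. (fst m - fst n, snd m - snd n)"
  by (simp add: blinfun.diff_left cstar_minus algebra_simps)
lift_definition uminus_multiplier :: "'a multiplier \<Rightarrow> 'a multiplier"
  is "\<lambda>m. (- fst m, - snd m)"
  by (simp add: blinfun.minus_left)
lift_definition scaleR_multiplier :: "real \<Rightarrow> 'a multiplier \<Rightarrow> 'a multiplier"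
  is "\<lambda>r m. (r *\<^sub>R fst m, r *\<^sub>R snd m)"
  by (simp add: blinfun.scaleR_left cstar_scaleR)
lift_definition times_multiplier :: "'a multiplier \<Rightarrow> 'a multiplier \<Rightarrow> 'a multiplier"
  is "\<lambda>m n. (fst m o\<^sub>L fst n, snd n o\<^sub>L snd m)"
  by simp

definition norm_multiplier :: "'a multiplier \<Rightarrow> real" where "norm_multiplier m = norm (app m)"
definition dist_multiplier :: "'a multiplier \<Rightarrow> 'a multiplier \<Rightarrow> real"
  where "dist_multiplier m n = norm (m - n)"
definition sgn_multiplier :: "'a multiplier \<Rightarrow> 'a multiplier"
  where "sgn_multiplier m = scaleR (inverse (norm m)) m"
definition uniformity_multiplier :: "('a multiplier \<times> 'a multiplier) filter"
  where "uniformity_multiplier = (INF e\<in>{0<..}. principal {(m, n). dist m n < e})"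
definition open_multiplier :: "'a multiplier set \<Rightarrow> bool"
  where "open_multiplier U \<longleftrightarrow> (\<forall>m\<in>U. eventually (\<lambda>(m', n). m' = m \<longrightarrow> n \<in> U) uniformity)"

lemma app_simps [simp]:
  "app 0 = 0" "app (m + n) = app m + app n" "app (m - n) = app m - app n" "app (- m) = - app m"
  "app (r *\<^sub>R m) = r *\<^sub>R app m" "app (m * n) = app m o\<^sub>L app n"
  for m n :: "'a multiplier"
  by (transfer; simp)+

lemma adj_diff: "adj (m - n) = adj m - adj n"
  for m n :: "'a multiplier"
  by transfer simp

instance
proof
  fix m n p :: "'a multiplier" and r s :: real
  note app = blinfun.add_left blinfun.diff_left blinfun.minus_left blinfun.scaleR_left
    blinfun.add_right blinfun.scaleR_right
  show "m + n + p = m + (n + p)" by (rule multiplier_eqI) (simp add: app)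
  show "m + n = n + m" by (rule multiplier_eqI) (simp add: app)
  show "0 + m = m" by (rule multiplier_eqI) (simp add: app)
  show "- m + m = 0" by (rule multiplier_eqI) (simp add: app)
  show "m - n = m + - n" by (rule multiplier_eqI) (simp add: app)
  show "r *\<^sub>R (m + n) = r *\<^sub>R m + r *\<^sub>R n"
    by (rule multiplier_eqI) (simp add: app algebra_simps)
  show "(r + s) *\<^sub>R m = r *\<^sub>R m + s *\<^sub>R m" by (rule multiplier_eqI) (simp add: app algebra_simps)
  show "r *\<^sub>R s *\<^sub>R m = (r * s) *\<^sub>R m" by (rule multiplier_eqI) (simp add: app)
  show "1 *\<^sub>R m = m" by (rule multiplier_eqI) (simp add: app)
  show "m * n * p = m * (n * p)" by (rule multiplier_eqI) simp
  show "(m + n) * p = m * p + n * p" by (rule multiplier_eqI) (simp add: app)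
  show "m * (n + p) = m * n + m * p" by (rule multiplier_eqI) (simp add: app)
  show "r *\<^sub>R m * n = r *\<^sub>R (m * n)" by (rule multiplier_eqI) (simp add: app)
  show "m * r *\<^sub>R n = r *\<^sub>R (m * n)" by (rule multiplier_eqI) (simp add: app)
  show "dist m n = norm (m - n)" by (simp add: dist_multiplier_def)
  show "sgn m = inverse (norm m) *\<^sub>R m" by (simp add: sgn_multiplier_def)
  show "uniformity = (INF e\<in>{0<..}. principal {(m, n :: 'a multiplier). dist m n < e})"
    by (simp add: uniformity_multiplier_def)
  show "open U \<longleftrightarrow> (\<forall>m\<in>U. eventually (\<lambda>(m', n). m' = m \<longrightarrow> n \<in> U) uniformity)"
    for U :: "'a multiplier set"
    by (simp add: open_multiplier_def)
  show "norm m = 0 \<longleftrightarrow> m = 0"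
    by (auto simp: norm_multiplier_def intro: multiplier_eqI)
  show "norm (m + n) \<le> norm m + norm n" by (simp add: norm_multiplier_def norm_triangle_ineq)
  show "norm (r *\<^sub>R m) = \<bar>r\<bar> * norm m" by (simp add: norm_multiplier_def)
  show "norm (m * n) \<le> norm m * norm n" by (simp add: norm_multiplier_def norm_blinfun_compose)
qed

end

text \<open>Both components of a Cauchy sequence converge, the adjoints by
  \<open>norm_adj_le\<close>, and the adjoint relation is closed under limits.\<close>

instance multiplier :: (cstar_algebra) banach
proof
  fix X :: "nat \<Rightarrow> 'a multiplier"
  assume "Cauchy X"
  then have cau: "\<exists>M. \<forall>m\<ge>M. \<forall>n\<ge>M. norm (app (X m) - app (X n)) < \<epsilon>" if "\<epsilon> > 0" for \<epsilon>
    using that by (simp add: Cauchy_def dist_multiplier_def norm_multiplier_def)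
  then have "Cauchy (\<lambda>n. app (X n))" by (simp add: Cauchy_def dist_norm)
  then obtain T where T: "(\<lambda>n. app (X n)) \<longlonglongrightarrow> T"
    using Cauchy_convergent by (auto simp: convergent_def)
  have "norm (adj (X m) - adj (X n)) \<le> norm (app (X m) - app (X n))" for m n
    using norm_adj_le[of "X m - X n"] by (simp add: adj_diff)
  then have "Cauchy (\<lambda>n. adj (X n))"
    using cau unfolding Cauchy_def dist_norm by (meson le_less_trans)
  then obtain S where S: "(\<lambda>n. adj (X n)) \<longlonglongrightarrow> S"
    using Cauchy_convergent by (auto simp: convergent_def)
  have TS: "cstar (T x) * y = cstar x * S y" for x y
  proof (rule LIMSEQ_unique)
    show "(\<lambda>n. cstar (app (X n) x) * y) \<longlonglongrightarrow> cstar (T x) * y"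
      by (intro tendsto_intros bounded_linear.tendsto[OF bounded_linear_cstar]
          blinfun.tendsto T)
    show "(\<lambda>n. cstar (app (X n) x) * y) \<longlonglongrightarrow> cstar x * S y"
      unfolding app_adj by (intro tendsto_intros blinfun.tendsto S)
  qed
  define L where "L = Abs_multiplier (T, S)"
  have L: "app L = T"
    using TS by (simp add: L_def app.rep_eq Abs_multiplier_inverse)
  have "X \<longlonglongrightarrow> L"
  proof (rule metric_LIMSEQ_I)
    fix \<epsilon> :: real assume "\<epsilon> > 0"
    then show "\<exists>N. \<forall>n\<ge>N. dist (X n) L < \<epsilon>"
      using metric_LIMSEQ_D[OF T] by (simp add: dist_multiplier_def norm_multiplier_def L dist_norm)
  qed
  then show "convergent X" by (auto simp: convergent_def)
qed

instantiation multiplier :: (cstar_algebra) cstar_algebra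
begin

lift_definition scaleC_multiplier :: "complex \<Rightarrow> 'a multiplier \<Rightarrow> 'a multiplier"
  is "\<lambda>c m. (scaleC_blinfun c o\<^sub>L fst m, scaleC_blinfun (cnj c) o\<^sub>L snd m)"
  by (simp add: cstar_scaleC scaleC_mult_left scaleC_mult_right)
lift_definition cstar_multiplier :: "'a multiplier \<Rightarrow> 'a multiplier"
  is "\<lambda>m. (snd m, fst m)"
  by simp (metis cstar_cstar cstar_mult)

lemma app_scaleC_cstar [simp]:
  "app (c *\<^sub>C m) = scaleC_blinfun c o\<^sub>L app m" "app (cstar m) = adj m" "adj (cstar m) = app m"
  for m :: "'a multiplier"
  by (transfer; simp)+

instance
proof
  fix m n :: "'a multiplier" and r :: real and c d :: complex
  note app = blinfun.add_left blinfun.scaleR_left blinfun.add_right app_scaleC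
  show "c *\<^sub>C (m + n) = c *\<^sub>C m + c *\<^sub>C n"
    by (rule multiplier_eqI) (simp add: app scaleC_add_right)
  show "(c + d) *\<^sub>C m = c *\<^sub>C m + d *\<^sub>C m"
    by (rule multiplier_eqI) (simp add: app scaleC_add_left)
  show "c *\<^sub>C d *\<^sub>C m = (c * d) *\<^sub>C m" by (rule multiplier_eqI) (simp add: scaleC_scaleC)
  show "1 *\<^sub>C m = m" by (rule multiplier_eqI) (simp add: scaleC_one)
  show "r *\<^sub>R m = complex_of_real r *\<^sub>C m" by (rule multiplier_eqI) (simp add: app scaleR_scaleC)
  show "(c *\<^sub>C m) * n = c *\<^sub>C (m * n)" by (rule multiplier_eqI) simp
  show "m * (c *\<^sub>C n) = c *\<^sub>C (m * n)" by (rule multiplier_eqI) (simp add: app)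
  show "cstar (cstar m) = m" by (rule multiplier_eqI) simp
  show "cstar (m + n) = cstar m + cstar n" by transfer simp
  show "cstar (c *\<^sub>C m) = cnj c *\<^sub>C cstar m" by transfer simp
  show "cstar (m * n) = cstar n * cstar m" by transfer simp
  have scaleC_le: "norm (a *\<^sub>C k) \<le> cmod a * norm k" for a and k :: "'a multiplier"
    unfolding norm_multiplier_def
    by (rule norm_blinfun_bound)
      (simp_all add: norm_scaleC mult.assoc mult_left_mono norm_blinfun)
  show "norm (c *\<^sub>C m) = cmod c * norm m"
  proof (cases "c = 0")
    case True
    then show ?thesis using scaleC_le[of c m] norm_ge_zero[of "app (c *\<^sub>C m)"]
      by (simp add: norm_multiplier_def)
  next
    case False
    have "inverse c *\<^sub>C c *\<^sub>C m = m"
      using False by (intro multiplier_eqI) (simp add: scaleC_scaleC scaleC_one)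
    then have "norm m \<le> inverse (cmod c) * norm (c *\<^sub>C m)"
      using scaleC_le[of "inverse c" "c *\<^sub>C m"] by (simp add: norm_inverse)
    then show ?thesis using scaleC_le[of c m] False by (simp add: field_simps)
  qed
  show "norm (cstar m * m) = (norm m)\<^sup>2"
  proof (rule antisym)
    have "norm (cstar m * m) \<le> norm (adj m) * norm (app m)"
      by (simp add: norm_multiplier_def norm_blinfun_compose)
    also have "\<dots> \<le> norm (app m) * norm (app m)" by (intro mult_right_mono norm_adj_le) simp
    finally show "norm (cstar m * m) \<le> (norm m)\<^sup>2"
      by (simp add: norm_multiplier_def power2_eq_square)
    \<comment> \<open>Conversely, the C*-identity of the algebra, taken at each
      \<open>app m x\<close>, bounds \<open>app m\<close> through
      \<open>cstar m * m\<close>.\<close>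
    have "norm (app m) \<le> sqrt (norm (cstar m * m))"
    proof (rule norm_blinfun_bound)
      fix x
      have "(norm (app m x))\<^sup>2 = norm (cstar x * app (cstar m * m) x)"
        using cstar_identity[of "app m x"] app_adj[of m x "app m x"] by simp
      also have "\<dots> \<le> norm x * (norm (cstar m * m) * norm x)"
        unfolding norm_multiplier_def
        by (intro order_trans[OF norm_mult_ineq] mult_mono norm_blinfun) auto
      finally have "norm (app m x) \<le> sqrt (norm (cstar m * m) * (norm x)\<^sup>2)"
        by (intro real_le_rsqrt) (simp add: power2_eq_square mult_ac)
      then show "norm (app m x) \<le> sqrt (norm (cstar m * m)) * norm x"
        by (simp add: real_sqrt_mult)
    qed (simp add: norm_multiplier_def)
    then have "(norm m)\<^sup>2 \<le> (sqrt (norm (cstar m * m)))\<^sup>2"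
      unfolding norm_multiplier_def[of m] by (intro power_mono) auto
    then show "(norm m)\<^sup>2 \<le> norm (cstar m * m)"
      by (simp add: norm_multiplier_def)
  qed
qed

end

section \<open>The unit and the isometric embedding of the algebra\<close>

lift_definition mult_one :: "'a::cstar_algebra multiplier" is "(id_blinfun, id_blinfun)" by simp

lemma app_mult_one [simp]: "app mult_one = id_blinfun"
  by transfer simp

interpretation multiplier: unital_cstar mult_one
  by standard (rule multiplier_eqI; simp)+

lift_definition lmult :: "'a::cstar_algebra \<Rightarrow> 'a multiplier"
  is "\<lambda>a. (blinfun_mult_right a, blinfun_mult_right (cstar a))"
  by (simp add: blinfun_mult_right.rep_eq cstar_mult mult.assoc)

lemma app_lmult [simp]: "app (lmult a) x = a * x"
  by transfer (simp add: blinfun_mult_right.rep_eq)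

lemma lmult_add: "lmult (a + b) = lmult a + lmult b"
  by (rule multiplier_eqI) (simp add: blinfun.add_left distrib_right)

lemma lmult_scaleR: "lmult (r *\<^sub>R a) = r *\<^sub>R lmult a"
  by (rule multiplier_eqI) (simp add: blinfun.scaleR_left)

lemma lmult_cstar_mult: "lmult (cstar b * b) = cstar (lmult b) * lmult b"
proof (rule multiplier_eqI)
  have "adj (lmult b) x = cstar b * x" for x
    by transfer (simp add: blinfun_mult_right.rep_eq)
  then show "app (lmult (cstar b * b)) x = app (cstar (lmult b) * lmult b) x" for x
    by (simp add: mult.assoc)
qed

text \<open>The lower bound is seen on the test vector \<open>cstar a\<close>, where
  \<open>norm (a * cstar a) = (norm a)\<^sup>2\<close>.\<close>

lemma norm_lmult: "norm (lmult a) = norm a"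
proof (rule antisym)
  show "norm (lmult a) \<le> norm a"
    unfolding norm_multiplier_def by (rule norm_blinfun_bound) (simp_all add: norm_mult_ineq)
  show "norm a \<le> norm (lmult a)"
  proof (cases "a = 0")
    case False
    have "(norm a)\<^sup>2 = norm (app (lmult a) (cstar a))"
      using cstar_identity[of "cstar a"] by (simp add: cstar_cstar)
    also have "\<dots> \<le> norm (lmult a) * norm (cstar a)"
      unfolding norm_multiplier_def by (rule norm_blinfun)
    finally show ?thesis using False by (simp add: power2_eq_square)
  qed simp
qed

text \<open>Defined through the unital algebra of multipliers, because closedness of the positive
  elements under addition is not apparent from \<^const>\<open>positive\<close>.\<close>

definition pos_cone :: "'a::cstar_algebra set" where
  "pos_cone = {h. multiplier.pos (lmult h)}"

lemma pos_cone_add: "h \<in> pos_cone \<Longrightarrow> g \<in> pos_cone \<Longrightarrow> h + g \<in> pos_cone"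
  by (simp add: pos_cone_def lmult_add multiplier.pos_add)

lemma pos_cone_scaleR: "0 \<le> t \<Longrightarrow> h \<in> pos_cone \<Longrightarrow> t *\<^sub>R h \<in> pos_cone"
  by (simp add: pos_cone_def lmult_scaleR multiplier.pos_scaleR)

lemma positive_in_pos_cone: "positive a \<Longrightarrow> a \<in> pos_cone"
  by (auto simp: positive_def pos_cone_def lmult_cstar_mult multiplier.pos_cstar_mult)

lemma zero_in_pos_cone: "0 \<in> pos_cone"
  by (rule positive_in_pos_cone) (auto simp: positive_def intro: exI[of _ 0])

lemma norm_mono_pos_cone: "h \<in> pos_cone \<Longrightarrow> g \<in> pos_cone \<Longrightarrow> norm h \<le> norm (h + g)"
  using multiplier.norm_mono[of "lmult h" "lmult g"]
  by (simp add: pos_cone_def norm_lmult flip: lmult_add)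

section \<open>States and orthogonality\<close>

lemma positive_selfadjoint: "positive a \<Longrightarrow> cstar a = a"
  by (auto simp: positive_def cstar_mult cstar_cstar)

lemma state_norm_le:
  assumes "is_state \<phi>"
  shows "cmod (\<phi> h) \<le> norm h"
proof (cases "h = 0")
  case True
  have "\<phi> (0 *\<^sub>C 0) = 0 * \<phi> 0" using assms unfolding is_state_def by blast
  then show ?thesis using True by simp
next
  case False
  define u where "u = complex_of_real (1 / norm h) *\<^sub>C h"
  have "norm u = 1" using False by (simp add: u_def norm_scaleC norm_divide)
  then have "cmod (\<phi> u) \<in> {cmod (\<phi> a) |a. norm a \<le> 1}" by force
  then have "cmod (\<phi> u) \<le> Sup {cmod (\<phi> a) |a. norm a \<le> 1}"
    using assms unfolding is_state_def by (intro cSup_upper) simp_all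
  then have "cmod (\<phi> u) \<le> 1" using assms by (simp add: is_state_def)
  moreover have "\<phi> u = complex_of_real (1 / norm h) * \<phi> h"
    using assms unfolding u_def is_state_def by blast
  ultimately show ?thesis using False by (simp add: norm_mult norm_divide divide_le_eq)
qed

text \<open>The real norming functional is symmetrised and then complexified. The cone
  \<open>C\<close> is left free: the positive cone yields plain norming states, while a larger cone
  can also make the state vanish on prescribed elements.\<close>

lemma state_exists:
  fixes a :: "'a::cstar_algebra"
  assumes a: "cstar a = a" "a \<noteq> 0"
    and pos: "\<And>b. positive b \<Longrightarrow> b \<in> C"
    and add: "\<And>c d. c \<in> C \<Longrightarrow> d \<in> C \<Longrightarrow> c + d \<in> C"
    and scale: "\<And>t c. 0 \<le> t \<Longrightarrow> c \<in> C \<Longrightarrow> t *\<^sub>R c \<in> C"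
    and dist: "\<And>t c. 0 \<le> t \<Longrightarrow> c \<in> C \<Longrightarrow> t * norm a \<le> norm (t *\<^sub>R a + c)"
  shows "\<exists>\<phi>. is_state \<phi> \<and> \<phi> a = complex_of_real (norm a) \<and>
    (\<forall>z. \<phi> (cstar z) = cnj (\<phi> z)) \<and> (\<forall>c\<in>C. cstar c = c \<longrightarrow> 0 \<le> Re (\<phi> c))"
proof -
  have "positive (0::'a)" by (auto simp: positive_def intro: exI[of _ 0])
  then obtain f where f: "linear f" "\<And>x. f x \<le> norm x" "f a = norm a" "\<And>c. c \<in> C \<Longrightarrow> 0 \<le> f c"
    using norming_functional_nonneg_on_cone[OF pos add scale dist] by blast
  \<comment> \<open>Averaging makes the functional invariant under \<open>cstar\<close>, keeps the
    norm bound and leaves it unchanged on self-adjoint elements.\<close>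
  define g where "g z = f ((1/2) *\<^sub>R (z + cstar z))" for z
  have g_add: "g (y + z) = g y + g z" for y z
    unfolding g_def linear_add[OF f(1), symmetric] by (simp add: cstar_add algebra_simps)
  have g_scaleR: "g (r *\<^sub>R z) = r * g z" for r z
    unfolding g_def using linear_scale[OF f(1), of r "(1/2) *\<^sub>R (z + cstar z)"]
    by (simp add: cstar_scaleR algebra_simps)
  have g_sa: "g z = f z" if "cstar z = z" for z
    using that by (simp add: g_def flip: scaleR_2)
  have g_star: "g (cstar z) = g z" for z
    by (simp add: g_def cstar_cstar add.commute)
  have g_le: "g z \<le> norm z" for z
  proof -
    have "g z \<le> norm ((1/2) *\<^sub>R (z + cstar z))" unfolding g_def by (rule f(2))
    also have "\<dots> \<le> norm z" using norm_triangle_ineq[of z "cstar z"] by simp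
    finally show ?thesis .
  qed
  have g_uminus: "g (- z) = - g z" for z using g_scaleR[of "-1" z] by simp
  \<comment> \<open>The unique complex-linear functional with real part \<open>g\<close>.\<close>
  define \<phi> where "\<phi> z = Complex (g z) (- g (\<i> *\<^sub>C z))" for z
  have \<phi>_add: "\<phi> (y + z) = \<phi> y + \<phi> z" for y z
    by (simp add: \<phi>_def g_add scaleC_add_right complex_eq_iff)
  have \<phi>_scaleC: "\<phi> (c *\<^sub>C z) = c * \<phi> z" for c z
  proof -
    have "g (d *\<^sub>C z) = Re d * g z + Im d * g (\<i> *\<^sub>C z)" for d
    proof -
      have "complex_of_real (Re d) + complex_of_real (Im d) * \<i> = d" by (simp add: complex_eq_iff)
      then have "d *\<^sub>C z = Re d *\<^sub>R z + Im d *\<^sub>R (\<i> *\<^sub>C z)"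
        by (simp add: scaleR_scaleC scaleC_scaleC flip: scaleC_add_left)
      then show ?thesis by (simp only: g_add g_scaleR)
    qed
    note gC = this
    show ?thesis
      using gC[of c] gC[of "\<i> * c"] by (simp add: \<phi>_def scaleC_scaleC complex_eq_iff)
  qed
  have \<phi>_star: "\<phi> (cstar z) = cnj (\<phi> z)" for z
    using g_star[of "\<i> *\<^sub>C cstar z"]
    by (simp add: \<phi>_def g_star cstar_scaleC cstar_cstar g_uminus complex_eq_iff)
  have \<phi>_sa: "\<phi> z = complex_of_real (f z)" if "cstar z = z" for z
    using \<phi>_star[of z] g_sa[OF that] that by (simp add: \<phi>_def complex_eq_iff)
  have \<phi>_le: "cmod (\<phi> z) \<le> norm z" for z
  proof (cases "\<phi> z = 0")
    case False
    define u where "u = cnj (\<phi> z) / cmod (\<phi> z)"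
    have u: "cmod u = 1" using False by (simp add: u_def norm_divide)
    have "u * \<phi> z = cmod (\<phi> z)"
      using False by (simp add: u_def mult.commute complex_norm_square[symmetric] power2_eq_square)
    then have "cmod (\<phi> z) = Re (\<phi> (u *\<^sub>C z))" by (simp add: \<phi>_scaleC)
    also have "\<dots> \<le> norm (u *\<^sub>C z)" by (simp add: \<phi>_def g_le)
    finally show ?thesis using u by (simp add: norm_scaleC)
  qed simp
  have \<phi>_a: "\<phi> a = complex_of_real (norm a)" using \<phi>_sa[OF a(1)] f(3) by simp
  have le1: "cmod (\<phi> z) \<le> 1" if "norm z \<le> 1" for z using \<phi>_le[of z] that by simp
  have "Sup {cmod (\<phi> z) |z. norm z \<le> 1} = 1"
  proof (rule cSup_eq_maximum)
    define u where "u = complex_of_real (1 / norm a) *\<^sub>C a"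
    have "norm u = 1" "cmod (\<phi> u) = 1"
      using a(2) by (simp_all add: u_def norm_scaleC \<phi>_scaleC \<phi>_a norm_divide norm_mult)
    then show "1 \<in> {cmod (\<phi> z) |z. norm z \<le> 1}" by force
  qed (use le1 in auto)
  moreover have "bdd_above {cmod (\<phi> z) |z. norm z \<le> 1}"
    by (rule bdd_aboveI[of _ 1]) (use le1 in auto)
  ultimately have "is_state \<phi>"
    unfolding is_state_def using \<phi>_add \<phi>_scaleC \<phi>_sa[OF positive_selfadjoint] f(4)[OF pos] by simp
  then show ?thesis
    using \<phi>_a \<phi>_star \<phi>_sa f(4) by (intro exI[of _ \<phi>]) simp
qed

lemma norming_state_exists:
  fixes a :: "'a::cstar_algebra"
  assumes "positive a" "a \<noteq> 0"
  shows "\<exists>\<phi>. is_state \<phi> \<and> \<phi> a = complex_of_real (norm a)"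
proof -
  have "t * norm a \<le> norm (t *\<^sub>R a + c)" if "0 \<le> t" "c \<in> pos_cone" for t c
    using norm_mono_pos_cone[OF pos_cone_scaleR[OF that(1) positive_in_pos_cone[OF assms(1)]] that(2)]
      that(1) by simp
  from state_exists[of a pos_cone, OF positive_selfadjoint[OF assms(1)] assms(2)
      positive_in_pos_cone pos_cone_add pos_cone_scaleR this]
  show ?thesis by blast
qed

text \<open>In the zero algebra every linear functional has norm 0, hence the hypothesis. The result
  covers \<open>x = 0\<close> and lets the infimum in \<open>m_val\<close> range over a nonempty
  set.\<close>

lemma states_nonempty:
  assumes "\<exists>a::'a::cstar_algebra. a \<noteq> 0"
  shows "\<exists>\<phi> :: 'a \<Rightarrow> complex. is_state \<phi>"
proof -
  obtain b :: 'a where "b \<noteq> 0" using assms by blast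
  then have "cstar b * b \<noteq> 0" using cstar_mult_eq_0 by blast
  moreover have "positive (cstar b * b)" by (auto simp: positive_def)
  ultimately show ?thesis using norming_state_exists by metis
qed

text \<open>The given state keeps the set nonempty and positivity bounds it below by 0, so
  \<open>Inf\<close> is a genuine infimum.\<close>

lemma m_val_nonneg_le:
  fixes ip :: "'x \<Rightarrow> 'x \<Rightarrow> 'a::cstar_algebra"
  assumes "positive (ip y y)" "\<phi> \<in> states"
  shows "0 \<le> m_val ip y" "m_val ip y \<le> Re (\<phi> (ip y y))"
proof -
  have nonneg: "0 \<le> Re (\<psi> (ip y y))" if "\<psi> \<in> states" for \<psi>
    using that assms(1) by (simp add: states_def is_state_def)
  show "0 \<le> m_val ip y"
    unfolding m_val_def by (rule cInf_greatest) (use assms(2) nonneg in auto)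
  show "m_val ip y \<le> Re (\<phi> (ip y y))"
    unfolding m_val_def
  proof (rule cInf_lower)
    show "bdd_below {Re (\<phi> (ip y y)) |\<phi>. \<phi> \<in> states}"
      by (rule bdd_belowI[of _ 0]) (use nonneg in auto)
  qed (use assms(2) in blast)
qed

section \<open>Orthogonality in the module\<close>

lemma hnorm_square: "(hnorm ip x)\<^sup>2 = norm (ip x x)"
  by (simp add: hnorm_def)

lemma bj_orth_iff: "bj_orth ip x y \<longleftrightarrow> (\<forall>l. norm (ip x x) \<le> norm (ip (x + l *\<^sub>C y) (x + l *\<^sub>C y)))"
  by (simp add: bj_orth_def hnorm_def)

lemma ip_expand:
  assumes "hilbert_module act ip"
  shows "ip (x + l *\<^sub>C y) (x + l *\<^sub>C y) =
    ip x x + (l *\<^sub>C ip x y + cstar (l *\<^sub>C ip x y)) + ((cmod l)\<^sup>2) *\<^sub>R ip y y"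
proof -
  have *: "\<And>x y z. ip x (y + z) = ip x y + ip x z" "\<And>c x y. ip x (c *\<^sub>C y) = c *\<^sub>C ip x y"
    "\<And>x y z. ip (x + y) z = ip x z + ip y z" "\<And>c x y. ip (c *\<^sub>C x) y = cnj c *\<^sub>C ip x y"
    "\<And>x y. cstar (ip x y) = ip y x"
    using assms by (simp_all add: hilbert_module_def)
  have "(cmod l)\<^sup>2 *\<^sub>R ip y y = l *\<^sub>C cnj l *\<^sub>C ip y y"
    by (simp only: scaleR_scaleC complex_norm_square scaleC_scaleC)
  then show ?thesis
    by (simp add: * scaleC_add_right cstar_scaleC add_ac)
qed

text \<open>Orthogonality gives \<open>\<parallel>a\<parallel> \<le> \<parallel>a + s v\<parallel> + O(s\<^sup>2)\<close> for \<open>s \<rightarrow> 0\<close>, and convexity of the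
  norm removes the error term.\<close>

lemma orthogonal_cone_bound:
  fixes ip :: "'x::cvec \<Rightarrow> 'x \<Rightarrow> 'a::cstar_algebra" and l :: complex
  assumes ip: "hilbert_module act ip" and orth: "bj_orth ip x y"
    and k: "k \<in> pos_cone" and t: "0 \<le> t"
  defines "v \<equiv> l *\<^sub>C ip x y + cstar (l *\<^sub>C ip x y)"
  shows "t * norm (ip x x) \<le> norm (t *\<^sub>R ip x x + (k + v))"
proof -
  define a where "a = ip x x"
  define N where "N = norm (t *\<^sub>R a + (k + v))"
  define D where "D = (cmod l)\<^sup>2 * norm (ip y y)"
  have D: "0 \<le> D" by (simp add: D_def)
  have pos: "positive (ip z z)" for z using ip by (simp add: hilbert_module_def)
  have step: "t * norm a \<le> N + s * D" if s: "0 < s" "s * t \<le> 1" for s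
  proof -
    let ?z = "x + (complex_of_real s * l) *\<^sub>C y"
    have z: "ip ?z ?z = a + s *\<^sub>R v + (s\<^sup>2 * (cmod l)\<^sup>2) *\<^sub>R ip y y"
      unfolding ip_expand[OF ip] v_def a_def
      by (simp add: norm_mult power_mult_distrib cstar_scaleR scaleR_add_right
          flip: scaleC_scaleC scaleR_scaleC)
    have "norm a \<le> norm (ip ?z ?z)" using orth by (simp add: bj_orth_iff a_def)
    also have "\<dots> \<le> norm (ip ?z ?z + s *\<^sub>R k)"
      using s by (intro norm_mono_pos_cone[OF positive_in_pos_cone[OF pos]] pos_cone_scaleR k) simp
    \<comment> \<open>A share \<open>s * t\<close> of \<open>a\<close> is moved into the vector
      whose norm is \<open>N\<close>; \<open>s * t \<le> 1\<close> keeps the remaining coefficient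
      nonnegative.\<close>
    also have "ip ?z ?z + s *\<^sub>R k =
        ((1 - s * t) *\<^sub>R a + s *\<^sub>R (t *\<^sub>R a + (k + v))) + (s\<^sup>2 * (cmod l)\<^sup>2) *\<^sub>R ip y y"
      unfolding z by (simp add: algebra_simps)
    also have "norm \<dots> \<le> (norm ((1 - s * t) *\<^sub>R a) + norm (s *\<^sub>R (t *\<^sub>R a + (k + v))))
        + norm ((s\<^sup>2 * (cmod l)\<^sup>2) *\<^sub>R ip y y)"
      by (intro order_trans[OF norm_triangle_ineq] add_mono norm_triangle_ineq order_refl)
    also have "\<dots> = (1 - s * t) * norm a + s * N + s\<^sup>2 * D"
      using s by (simp add: N_def D_def)
    finally have "s * (t * norm a) \<le> s * (N + s * D)"
      by (simp add: algebra_simps power2_eq_square)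
    then show ?thesis using s(1) by simp
  qed
  have "t * norm a \<le> N"
  proof (rule ccontr)
    assume "\<not> t * norm a \<le> N"
    then have gap: "0 < t * norm a - N" by simp
    \<comment> \<open>The first bound ensures \<open>s * t \<le> 1\<close>, the second makes the
      error \<open>s * D\<close> smaller than the gap.\<close>
    define s where "s = min (1 / (t + 1)) ((t * norm a - N) / (D + 1))"
    have s: "0 < s" "s \<le> 1 / (t + 1)" "s \<le> (t * norm a - N) / (D + 1)"
      using t D gap by (auto simp: s_def)
    have "s * t \<le> 1"
      using s(1,2) t by (simp add: field_simps)
    moreover have "s * (D + 1) \<le> t * norm a - N" using s(3) D by (simp add: field_simps)
    ultimately show False using step[OF s(1)] s(1) by (simp add: algebra_simps)
  qed
  then show ?thesis by (simp add: a_def N_def)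
qed

text \<open>\<open>C\<close> is the positive cone plus the real subspace of all \<open>V l\<close>,
  and \<open>orthogonal_cone_bound\<close> is its distance hypothesis. Nonnegativity on a subspace
  means vanishing, which forces \<open>\<phi> b = 0\<close>.\<close>

lemma bj_orth_imp_state:
  fixes ip :: "'x::cvec \<Rightarrow> 'x \<Rightarrow> 'a::cstar_algebra"
  assumes ip: "hilbert_module act ip" and nz: "\<exists>a::'a. a \<noteq> 0" and orth: "bj_orth ip x y"
  shows "\<exists>\<phi>\<in>Omega ip x. \<phi> (ip x y) = 0"
proof (cases "ip x x = 0")
  case True
  \<comment> \<open>Here every state lies in \<open>Omega ip x\<close> and kills
    \<open>ip x y\<close>.\<close>
  then have "x = 0" using ip by (simp add: hilbert_module_def)
  moreover have "ip (0 + 0) y = ip 0 y + ip 0 y" using ip unfolding hilbert_module_def by blast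
  ultimately have xy: "ip x y = 0" by simp
  obtain \<phi> :: "'a \<Rightarrow> complex" where \<phi>: "is_state \<phi>" using states_nonempty[OF nz] by blast
  have "\<phi> 0 = 0" using state_norm_le[OF \<phi>, of 0] by simp
  then show ?thesis using \<phi> True xy by (auto simp: Omega_def states_def hnorm_def)
next
  case False
  define a where "a = ip x x"
  define b where "b = ip x y"
  define V where "V l = l *\<^sub>C b + cstar (l *\<^sub>C b)" for l
  define C where "C = {k + V l |k l. k \<in> pos_cone}"
  have V0: "V 0 = 0" by (simp add: V_def)
  have V_add: "V l + V m = V (l + m)" for l m by (simp add: V_def scaleC_add_left cstar_add)
  have V_scale: "r *\<^sub>R V l = V (complex_of_real r * l)" for r l
    by (simp add: V_def scaleR_add_right cstar_scaleR flip: scaleC_scaleC scaleR_scaleC)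
  have pos: "positive a" using ip by (simp add: a_def hilbert_module_def)
  have "\<exists>\<phi>. is_state \<phi> \<and> \<phi> a = complex_of_real (norm a) \<and>
    (\<forall>z. \<phi> (cstar z) = cnj (\<phi> z)) \<and> (\<forall>c\<in>C. cstar c = c \<longrightarrow> 0 \<le> Re (\<phi> c))"
  proof (rule state_exists[of a C])
    show "cstar a = a" "a \<noteq> 0" using False pos by (simp_all add: a_def positive_selfadjoint)
    show "c \<in> C" if "positive c" for c
      using positive_in_pos_cone[OF that] V0 unfolding C_def by force
    show "c + d \<in> C" if cd: "c \<in> C" "d \<in> C" for c d
    proof -
      obtain k l k' l' where "c = k + V l" "d = k' + V l'" and k: "k \<in> pos_cone" "k' \<in> pos_cone"
        using cd by (auto simp: C_def)
      then have "c + d = (k + k') + V (l + l')" by (simp flip: V_add)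
      then show ?thesis using pos_cone_add[OF k] unfolding C_def by blast
    qed
    show "t *\<^sub>R c \<in> C" if t: "0 \<le> t" and c: "c \<in> C" for t c
    proof -
      obtain k l where "c = k + V l" and k: "k \<in> pos_cone" using c by (auto simp: C_def)
      then have "t *\<^sub>R c = t *\<^sub>R k + V (complex_of_real t * l)"
        by (simp add: scaleR_add_right V_scale)
      then show ?thesis using pos_cone_scaleR[OF t k] unfolding C_def by blast
    qed
    show "t * norm a \<le> norm (t *\<^sub>R a + c)" if "0 \<le> t" "c \<in> C" for t c
      using that orthogonal_cone_bound[OF ip orth]
      by (auto simp: C_def V_def a_def b_def)
  qed
  then obtain \<phi> where \<phi>: "is_state \<phi>" "\<phi> a = complex_of_real (norm a)"
    and star: "\<And>z. \<phi> (cstar z) = cnj (\<phi> z)"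
    and nonneg: "\<And>c. c \<in> C \<Longrightarrow> cstar c = c \<Longrightarrow> 0 \<le> Re (\<phi> c)"
    by blast
  \<comment> \<open>For this \<open>l\<close> the value \<open>\<phi> (V l)\<close> is
    \<open>- 2 * (cmod (\<phi> b))\<^sup>2\<close>, so nonnegativity leaves only zero.\<close>
  define l where "l = - cnj (\<phi> b)"
  have "V l \<in> C" using zero_in_pos_cone unfolding C_def by force
  moreover have "cstar (V l) = V l" by (simp add: V_def cstar_add cstar_cstar add.commute)
  ultimately have "0 \<le> Re (\<phi> (V l))" by (rule nonneg)
  moreover have "\<phi> (V l) = l * \<phi> b + cnj (l * \<phi> b)"
    using \<phi>(1) by (simp add: V_def star is_state_def)
  moreover have "l * \<phi> b = - complex_of_real ((cmod (\<phi> b))\<^sup>2)"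
    unfolding complex_norm_square by (simp add: l_def mult.commute)
  ultimately have "\<phi> b = 0" by simp
  then show ?thesis
    using \<phi> by (intro bexI[of _ \<phi>]) (simp_all add: Omega_def states_def hnorm_def a_def b_def)
qed

lemma state_imp_norm_bound:
  fixes ip :: "'x::cvec \<Rightarrow> 'x \<Rightarrow> 'a::cstar_algebra"
  assumes ip: "hilbert_module act ip" and \<phi>: "\<phi> \<in> Omega ip x" "\<phi> (ip x y) = 0"
  shows "(hnorm ip x)\<^sup>2 + (cmod l)\<^sup>2 * m_val ip y \<le> (hnorm ip (x + l *\<^sub>C y))\<^sup>2"
proof -
  have st: "is_state \<phi>" and x: "\<phi> (ip x x) = complex_of_real ((hnorm ip x)\<^sup>2)"
    using \<phi>(1) by (simp_all add: Omega_def states_def)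
  have add: "\<phi> (u + v) = \<phi> u + \<phi> v" and scale: "\<phi> (c *\<^sub>C u) = c * \<phi> u" for u v c
    using st unfolding is_state_def by blast+
  have pos: "positive (ip z z)" for z using ip by (simp add: hilbert_module_def)
  have real: "Im (\<phi> (ip z z)) = 0" for z using st pos unfolding is_state_def by blast
  have expand: "\<phi> (ip (x + c *\<^sub>C y) (x + c *\<^sub>C y)) =
      complex_of_real ((hnorm ip x)\<^sup>2) + cnj c * \<phi> (cstar (ip x y))
        + complex_of_real ((cmod c)\<^sup>2) * \<phi> (ip y y)" for c
    unfolding ip_expand[OF ip]
    by (simp only: add scale scaleR_scaleC cstar_scaleC x \<phi>(2)) simp
  \<comment> \<open>Only \<open>\<phi> (ip x y) = 0\<close> is given. Values on
    \<open>ip z z\<close> are real, so the other cross term is real for every \<open>c\<close>;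
    \<open>c = 1\<close> and \<open>c = \<i>\<close> show that its imaginary and real parts
    vanish.\<close>
  have "Im (cnj c * \<phi> (cstar (ip x y))) = 0" for c
    using real[of "x + c *\<^sub>C y"] real[of y] unfolding expand by (simp flip: of_real_power)
  from this[of 1] this[of \<i>] have yx: "\<phi> (cstar (ip x y)) = 0"
    by (simp add: complex_eq_iff)
  have "(hnorm ip x)\<^sup>2 + (cmod l)\<^sup>2 * m_val ip y \<le> (hnorm ip x)\<^sup>2 + (cmod l)\<^sup>2 * Re (\<phi> (ip y y))"
    using m_val_nonneg_le(2)[of ip y \<phi>] pos st by (simp add: states_def mult_left_mono)
  also have "\<dots> = Re (\<phi> (ip (x + l *\<^sub>C y) (x + l *\<^sub>C y)))"
    unfolding expand yx by (simp flip: of_real_power)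
  also have "\<dots> \<le> norm (ip (x + l *\<^sub>C y) (x + l *\<^sub>C y))"
    using complex_Re_le_cmod state_norm_le[OF st] by (rule order_trans)
  finally show ?thesis by (simp add: hnorm_square[of ip "x + l *\<^sub>C y"])
qed

theorem theorem3p2:
  fixes act :: "'x::cvec \<Rightarrow> 'a::cstar_algebra \<Rightarrow> 'x"
    and ip :: "'x \<Rightarrow> 'x \<Rightarrow> 'a"
    and x y :: 'x
  assumes "hilbert_module act ip"
    and "\<exists>a::'a. a \<noteq> 0"
  shows "(bj_orth ip x y \<longleftrightarrow> (\<exists>\<phi>\<in>Omega ip x. \<phi> (ip x y) = 0))
       \<and> ((\<exists>\<phi>\<in>Omega ip x. \<phi> (ip x y) = 0) \<longleftrightarrow>
           (\<forall>l::complex. (hnorm ip (x + l *\<^sub>C y))\<^sup>2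
               \<ge> (hnorm ip x)\<^sup>2 + (cmod l)\<^sup>2 * m_val ip y))"
proof -
  let ?iii = "\<forall>l::complex. (hnorm ip x)\<^sup>2 + (cmod l)\<^sup>2 * m_val ip y \<le> (hnorm ip (x + l *\<^sub>C y))\<^sup>2"
  obtain \<psi> :: "'a \<Rightarrow> complex" where "is_state \<psi>" using states_nonempty[OF assms(2)] by blast
  moreover have "positive (ip y y)" using assms(1) by (simp add: hilbert_module_def)
  ultimately have m: "0 \<le> m_val ip y"
    using m_val_nonneg_le(1)[of ip y \<psi>] by (simp add: states_def)
  have "bj_orth ip x y" if iii: ?iii
    unfolding bj_orth_iff
  proof
    fix l
    have "(hnorm ip x)\<^sup>2 \<le> (hnorm ip x)\<^sup>2 + (cmod l)\<^sup>2 * m_val ip y" using m by simp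
    also have "\<dots> \<le> (hnorm ip (x + l *\<^sub>C y))\<^sup>2" using iii by blast
    finally show "norm (ip x x) \<le> norm (ip (x + l *\<^sub>C y) (x + l *\<^sub>C y))"
      by (simp add: hnorm_square)
  qed
  moreover have ?iii if "\<exists>\<phi>\<in>Omega ip x. \<phi> (ip x y) = 0"
    using that state_imp_norm_bound[OF assms(1)] by blast
  ultimately show ?thesis using bj_orth_imp_state[OF assms] by blast
qed

end
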